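(* Let $D$ be the open unit ball of a complex Hilbert space and let $f: D\to D$ be a fixed-point free holomorphic map. Then there is a boundary point $\zeta\in\partial D$ such that, for every limit function $\ell=\lim_k f^{n_k}$ of the iterates $(f^n)$, either $\ell(D)\subset D$ or $\ell(D)=\{\zeta\}$. The former inclusion cannot occur if $\dim D<\infty$.
   Context: $f^n=f\circ\cdots\circ f$ ($n$ times). A limit function of $(f^n)$ is a limit $\ell=\lim_k f^{n_k}$ of a subsequence of the iterates in the topology of locally uniform convergence, i.e. uniform convergence on every finite union of closed balls strictly contained in $D$. $\dim D$ is the dimension of the underlying Hilbert space, which may be infinite; $\partial D$ is the topological boundary. *)

theory Defs
  imports "HOL-Analysis.Analysis"
begin

section \<open>Complex Hilbert spaces\<close>

text \<open>
  A complex inner product space is presented on top of its underlying real inner product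
  space, so that norm, topology and real Frechet derivatives are those of the library.
  The real inner product is the real part of the complex one; hence \<open>cinner x x\<close>
  is the real number \<open>inner x x\<close>, and positive definiteness and
  \<open>norm x = sqrt (cinner x x)\<close> are inherited from \<^class>\<open>real_inner\<close>.
\<close>

class complex_inner = real_inner +
  fixes scaleC :: "complex \<Rightarrow> 'a \<Rightarrow> 'a"  (infixr "*\<^sub>C" 75)
    and cinner :: "'a \<Rightarrow> 'a \<Rightarrow> complex"
  assumes scaleC_add_right: "c *\<^sub>C (x + y) = c *\<^sub>C x + c *\<^sub>C y"
    and scaleC_add_left: "(c + d) *\<^sub>C x = c *\<^sub>C x + d *\<^sub>C x"
    and scaleC_scaleC: "c *\<^sub>C (d *\<^sub>C x) = (c * d) *\<^sub>C x"
    and scaleC_one: "1 *\<^sub>C x = x"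
    and scaleR_scaleC: "r *\<^sub>R x = complex_of_real r *\<^sub>C x"
    and cinner_commute: "cinner x y = cnj (cinner y x)"
    and cinner_add_left: "cinner (x + y) z = cinner x z + cinner y z"
    and cinner_scaleC_left: "cinner (c *\<^sub>C x) y = c * cinner x y"
    and Re_cinner: "Re (cinner x y) = inner x y"

class complex_hilbert_space = complex_inner + complete_space
begin

subclass banach ..

end

global_interpretation complex_vector:
  vector_space "scaleC :: complex \<Rightarrow> 'a \<Rightarrow> 'a::complex_inner"
  defines cspan = complex_vector.span
  by unfold_locales
    (simp_all add: scaleC_add_right scaleC_add_left scaleC_scaleC scaleC_one)

text \<open>The argument only serves to select the type.\<close>

definition finite_cdim :: "'a::complex_inner itself \<Rightarrow> bool" where
  "finite_cdim _ \<longleftrightarrow> (\<exists>B::'a set. finite B \<and> cspan B = UNIV)"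

section \<open>Holomorphic maps\<close>

text \<open>
  The library's \<^const>\<open>holomorphic_on\<close> only treats one complex variable. Here holomorphic
  means Frechet differentiable with complex-linear derivative; boundedness of the derivative
  is part of \<^const>\<open>has_derivative\<close>. Intended for open \<open>U\<close>.
\<close>

definition holomorphic_map_on ::
    "('a::complex_inner \<Rightarrow> 'b::complex_inner) \<Rightarrow> 'a set \<Rightarrow> bool" where
  "holomorphic_map_on f U \<longleftrightarrow>
     (\<forall>x\<in>U. \<exists>f'. (f has_derivative f') (at x within U) \<and>
                 (\<forall>c v. f' (c *\<^sub>C v) = c *\<^sub>C f' v))"

section \<open>Limit functions of iterates\<close>

text \<open>Strict containment means containment at a positive distance from the complement.\<close>

definition strictly_contained :: "'a::metric_space set \<Rightarrow> 'a set \<Rightarrow> bool" where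
  "strictly_contained B D \<longleftrightarrow> (\<exists>e>0. \<forall>x\<in>B. ball x e \<subseteq> D)"

definition locally_uniform_limit_on ::
    "'a::metric_space set \<Rightarrow> (nat \<Rightarrow> 'a \<Rightarrow> 'b::metric_space) \<Rightarrow> ('a \<Rightarrow> 'b) \<Rightarrow> bool" where
  "locally_uniform_limit_on D g l \<longleftrightarrow>
     (\<forall>\<B>. finite \<B> \<and>
          (\<forall>B\<in>\<B>. (\<exists>a r. r > 0 \<and> B = cball a r) \<and> strictly_contained B D)
        \<longrightarrow> uniform_limit (\<Union>\<B>) g l sequentially)"

text \<open>
  Maps on \<open>D\<close> are represented by total functions; only the values of \<open>l\<close> on \<open>D\<close> matter.
\<close>

definition limit_function ::
    "'a::metric_space set \<Rightarrow> ('a \<Rightarrow> 'a) \<Rightarrow> ('a \<Rightarrow> 'a) \<Rightarrow> bool" where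
  "limit_function D f l \<longleftrightarrow>
     (\<exists>n::nat \<Rightarrow> nat. strict_mono n \<and> locally_uniform_limit_on D (\<lambda>k. f ^^ n k) l)"

end

theory Submission
  imports Defs "HOL-Complex_Analysis.Conformal_Mappings"
begin

text \<open>
  Everything rests on one function, \<open>hsigma x y\<close>, which is
  \<open>(1 - |x|\<^sup>2)(1 - |y|\<^sup>2) / |1 - <x,y>|\<^sup>2\<close>; the number \<open>sqrt (1 - hsigma x y)\<close> is the
  pseudo-hyperbolic distance of the ball. Holomorphy enters through the Schwarz-Pick inequality
  \<open>Schwarz_Pick_ball\<close>: holomorphic self-maps of the ball do not decrease \<open>hsigma\<close>, that is,
  they are nonexpansive for this distance. The rest of the argument is metric.

  The boundary point is the limit of approximating fixed points. For \<open>0 < t < 1\<close> the map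
  \<open>t f\<close> contracts the pseudo-hyperbolic distance by a constant factor, so it has a fixed point
  \<open>x\<^sub>t\<close>. Comparing \<open>x\<^sub>s\<close> and \<open>x\<^sub>t\<close> with their images, which lie further out on the same rays,
  gives \<open>|x\<^sub>s - x\<^sub>t|\<^sup>2 \<le> |x\<^sub>t|\<^sup>2 - |x\<^sub>s|\<^sup>2\<close> for \<open>s \<le> t\<close>
  (\<open>approximating_fixed_points_dist\<close>). Hence \<open>|x\<^sub>t|\<close> increases and \<open>x\<^sub>t\<close> converges in norm, in any
  dimension, to some \<open>\<zeta>\<close>. If \<open>\<zeta>\<close> were in the open ball it would be a fixed point of \<open>f\<close>; so
  \<open>|\<zeta>| = 1\<close>.

  Letting \<open>t\<close> tend to 1 in the Schwarz-Pick inequality for a point \<open>z\<close> and \<open>x\<^sub>t\<close> yields Wolff's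
  theorem: \<open>|1 - <z,\<zeta>>|\<^sup>2 / (1 - |z|\<^sup>2)\<close> does not increase along orbits. Therefore an orbit can
  only accumulate on the sphere at \<open>\<zeta>\<close>. If a limit function takes one value on the sphere,
  then all its values coincide, because \<open>hsigma\<close> of two orbits stays bounded below. This is the
  first assertion.

  Suppose now that the dimension is finite and a limit function maps the ball into itself. Its
  value \<open>y\<close> at the origin is a recurrent point: \<open>f\<^sup>m y\<close> returns arbitrarily close to \<open>y\<close>
  for arbitrarily large \<open>m\<close>. On the orbit of such a point \<open>f\<close> preserves distances, and
  together with compactness Calka's argument shows that the return times to a small neighbourhood
  of \<open>y\<close> have bounded gaps, so that the whole orbit stays in a ball of radius \<open>r < 1\<close>
  (\<open>recurrent_orbit_bounded\<close>). But along an orbit in such a ball, an approximating fixed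
  point with \<open>|x\<^sub>t|\<^sup>2 > r\<close> would make a quantity that is bounded away from 0 decay geometrically
  (\<open>bounded_orbit_bounds_approximants\<close>), which contradicts \<open>|x\<^sub>t| \<rightarrow> 1\<close>.
\<close>

section \<open>Complex inner products\<close>

lemma cinner_add_right: "cinner x (y + z) = cinner x y + cinner x (z::'a::complex_inner)"
  by (metis cinner_add_left cinner_commute complex_cnj_add)

lemma cinner_scaleC_right: "cinner x (c *\<^sub>C y) = cnj c * cinner x (y::'a::complex_inner)"
  by (metis cinner_commute cinner_scaleC_left complex_cnj_mult)

lemma cinner_scaleR_left: "cinner (r *\<^sub>R x) y = of_real r * cinner x (y::'a::complex_inner)"
  by (simp add: cinner_scaleC_left scaleR_scaleC)

lemma cinner_scaleR_right: "cinner x (r *\<^sub>R y) = of_real r * cinner x (y::'a::complex_inner)"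
  by (simp add: cinner_scaleC_right scaleR_scaleC)

lemma cinner_diff_left: "cinner (x - y) z = cinner x z - cinner y (z::'a::complex_inner)"
  using cinner_add_left[of "x - y" y z] by simp

lemma cinner_self: "cinner x x = complex_of_real ((norm (x::'a::complex_inner))\<^sup>2)"
proof (rule complex_eqI)
  show "Re (cinner x x) = Re (complex_of_real ((norm x)\<^sup>2))"
    by (simp add: Re_cinner power2_norm_eq_inner)
  have "Im (cinner x x) = Im (cnj (cinner x x))"
    using cinner_commute[of x x] by simp
  then show "Im (cinner x x) = Im (complex_of_real ((norm x)\<^sup>2))" by simp
qed

lemma norm_scaleC: "norm (c *\<^sub>C x) = cmod c * norm (x::'a::complex_inner)"
proof -
  have "complex_of_real ((norm (c *\<^sub>C x))\<^sup>2) = complex_of_real ((cmod c * norm x)\<^sup>2)"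
    unfolding power_mult_distrib of_real_mult complex_norm_square[of c] cinner_self[symmetric]
      cinner_scaleC_left cinner_scaleC_right by (simp add: mult_ac)
  then have "(norm (c *\<^sub>C x))\<^sup>2 = (cmod c * norm x)\<^sup>2"
    using of_real_eq_iff by blast
  then show ?thesis by (simp add: power2_eq_iff_nonneg)
qed

text \<open>A unimodular factor makes the complex inner product real and nonnegative, which reduces
  the inequality to its real form.\<close>

lemma cinner_Cauchy_Schwarz: "cmod (cinner x y) \<le> norm x * norm (y::'a::complex_inner)"
proof (cases "cinner x y = 0")
  case False
  define u where "u = cnj (cinner x y) / of_real (cmod (cinner x y))"
  have u: "cmod u = 1" using False by (simp add: u_def norm_divide)
  have "u * cinner x y = of_real (cmod (cinner x y))"
    using False by (simp add: u_def complex_norm_square[symmetric] power2_eq_square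
        mult.commute[of "cnj _"])
  then have "cmod (cinner x y) = inner (u *\<^sub>C x) y"
    by (metis Re_cinner Re_complex_of_real cinner_scaleC_left)
  also have "\<dots> \<le> norm (u *\<^sub>C x) * norm y" by (rule norm_cauchy_schwarz)
  finally show ?thesis by (simp add: norm_scaleC u)
qed simp

lemma bounded_bilinear_cinner:
  "bounded_bilinear (cinner :: 'a::complex_inner \<Rightarrow> 'a \<Rightarrow> complex)"
proof
  show "\<exists>K. \<forall>a b::'a. cmod (cinner a b) \<le> norm a * norm b * K"
    by (rule exI[of _ 1]) (simp add: cinner_Cauchy_Schwarz)
qed (simp_all add: cinner_add_left cinner_add_right cinner_scaleR_left cinner_scaleR_right
       scaleR_conv_of_real)

lemmas tendsto_cinner = bounded_bilinear.tendsto[OF bounded_bilinear_cinner]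

lemma bounded_linear_scaleC_left: "bounded_linear (\<lambda>c. c *\<^sub>C (e::'a::complex_inner))"
  by (rule bounded_linear_intro[where K="norm e"])
     (simp_all add: scaleC_add_left scaleR_scaleC scaleC_scaleC norm_scaleC scaleR_conv_of_real)

lemma norm_add_sq:
  "(norm (x + y))\<^sup>2 = (norm x)\<^sup>2 + (norm y)\<^sup>2 + 2 * Re (cinner x (y::'a::complex_inner))"
  by (simp add: power2_norm_eq_inner inner_add_left inner_add_right Re_cinner inner_commute)

lemma norm_diff_sq:
  "(norm (x - y))\<^sup>2 = (norm x)\<^sup>2 + (norm y)\<^sup>2 - 2 * Re (cinner x (y::'a::complex_inner))"
  by (simp add: power2_norm_eq_inner inner_diff_left inner_diff_right Re_cinner inner_commute)


section \<open>The hyperbolic invariant of a pair of points\<close>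

text \<open>Goebel, Sekowski and Stachura write \<open>\<sigma>(x,y)\<close> for this function. On the ball it equals 1 exactly
  on the diagonal and tends to 0 as the hyperbolic distance tends to infinity.\<close>

definition hsigma :: "'a::complex_inner \<Rightarrow> 'a \<Rightarrow> real" where
  "hsigma x y = (1 - (norm x)\<^sup>2) * (1 - (norm y)\<^sup>2) / (cmod (1 - cinner x y))\<^sup>2"

lemma one_minus_norm_sq_pos: "x \<in> ball 0 1 \<Longrightarrow> 0 < 1 - (norm (x::'a::complex_inner))\<^sup>2"
  by (simp add: power_less_one_iff abs_square_less_1)

lemma one_minus_cinner_lower:
  "1 - norm x * norm y \<le> cmod (1 - cinner x (y::'a::complex_inner))"
  using norm_triangle_ineq2[of 1 "cinner x y"] cinner_Cauchy_Schwarz[of x y] by simp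

lemma one_minus_cinner_sq_le:
  assumes "norm x \<le> 1" "norm (y::'a::complex_inner) \<le> 1"
  shows "(cmod (1 - cinner x y))\<^sup>2 \<le> 4"
proof -
  have "cmod (1 - cinner x y) \<le> 1 + cmod (cinner x y)"
    using norm_triangle_ineq4[of 1 "cinner x y"] by simp
  also have "\<dots> \<le> 1 + 1 * 1"
    using cinner_Cauchy_Schwarz[of x y] mult_mono[of "norm x" 1 "norm y" 1] assms by simp
  finally show ?thesis using power_mono[of "cmod (1 - cinner x y)" 2 2] by simp
qed

lemma one_minus_cinner_pos:
  assumes "x \<in> ball 0 1" "norm (y::'a::complex_inner) \<le> 1"
  shows "0 < cmod (1 - cinner x y)"
proof -
  have "norm x * norm y \<le> norm x * 1" by (rule mult_left_mono) (use assms in auto)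
  then have "norm x * norm y < 1" using assms by simp
  then show ?thesis using one_minus_cinner_lower[of x y] by linarith
qed

lemma hsigma_pos: "x \<in> ball 0 1 \<Longrightarrow> y \<in> ball 0 1 \<Longrightarrow> 0 < hsigma x (y::'a::complex_inner)"
  unfolding hsigma_def using one_minus_norm_sq_pos[of x] one_minus_norm_sq_pos[of y]
    one_minus_cinner_pos[of x y] by simp

lemma hsigma_self:
  assumes "x \<in> ball 0 1" shows "hsigma x (x::'a::complex_inner) = 1"
proof -
  have "1 - cinner x x = of_real (1 - (norm x)\<^sup>2)" by (simp add: cinner_self)
  then have "cmod (1 - cinner x x) = \<bar>1 - (norm x)\<^sup>2\<bar>" by (metis norm_of_real real_norm_def)
  then show ?thesis
    unfolding hsigma_def using one_minus_norm_sq_pos[OF assms] by (simp add: power2_eq_square)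
qed

lemma cmod_one_minus_sq: "(cmod (1 - w))\<^sup>2 = 1 - 2 * Re w + (cmod w)\<^sup>2"
  unfolding cmod_power2 by (simp add: power2_eq_square algebra_simps)

text \<open>The numerator is the squared norm distance diminished by the defect in the Cauchy-Schwarz
  inequality; the two comparisons with the norm distance below amount to bounds on that defect.\<close>

lemma one_minus_hsigma:
  assumes "x \<in> ball 0 1" "y \<in> ball 0 1"
  shows "1 - hsigma x y = ((norm (x - y))\<^sup>2 - ((norm x * norm y)\<^sup>2 - (cmod (cinner x y))\<^sup>2))
           / (cmod (1 - cinner x (y::'a::complex_inner)))\<^sup>2"
proof -
  have "(cmod (1 - cinner x y))\<^sup>2 \<noteq> 0"
    using one_minus_cinner_pos[of x y] assms by auto
  moreover have "(cmod (1 - cinner x y))\<^sup>2 - (1 - (norm x)\<^sup>2) * (1 - (norm y)\<^sup>2)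
      = (norm (x - y))\<^sup>2 - ((norm x * norm y)\<^sup>2 - (cmod (cinner x y))\<^sup>2)"
    unfolding cmod_one_minus_sq norm_diff_sq by (simp add: algebra_simps power2_eq_square)
  ultimately show ?thesis unfolding hsigma_def by (simp add: field_simps)
qed

lemma one_minus_hsigma_upper:
  assumes "x \<in> ball 0 1" "y \<in> ball 0 1"
  shows "1 - hsigma x y \<le> (norm (x - y))\<^sup>2 / (cmod (1 - cinner x (y::'a::complex_inner)))\<^sup>2"
proof -
  have "(cmod (cinner x y))\<^sup>2 \<le> (norm x * norm y)\<^sup>2"
    by (intro power_mono cinner_Cauchy_Schwarz) simp
  then show ?thesis unfolding one_minus_hsigma[OF assms] by (intro divide_right_mono) auto
qed

text \<open>The defect \<open>|x|\<^sup>2|y|\<^sup>2 - |<x,y>|\<^sup>2\<close> in the Cauchy-Schwarz inequality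
  is at most \<open>|x|\<^sup>2|x - y|\<^sup>2\<close>, because the difference is the squared modulus of
  \<open>|x|\<^sup>2 - <x,y>\<close>.\<close>

lemma norm_diff_sq_le_hsigma:
  assumes "x \<in> ball 0 1" "y \<in> ball 0 1"
  shows "(1 - (norm x)\<^sup>2) * (norm (x - y))\<^sup>2 \<le> 4 * (1 - hsigma x (y::'a::complex_inner))"
proof -
  let ?w = "cinner x y" and ?p = "(norm x)\<^sup>2"
  have id: "(cmod (of_real ?p - ?w))\<^sup>2 = ?p\<^sup>2 - 2 * ?p * Re ?w + (cmod ?w)\<^sup>2"
    unfolding cmod_power2 by (simp add: power2_eq_square algebra_simps)
  have "?p * (norm (x - y))\<^sup>2 = ?p\<^sup>2 + (norm x * norm y)\<^sup>2 - 2 * ?p * Re ?w"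
    unfolding norm_diff_sq by (simp add: algebra_simps power2_eq_square)
  then have "(norm x * norm y)\<^sup>2 - (cmod ?w)\<^sup>2 \<le> ?p * (norm (x - y))\<^sup>2"
    using id zero_le_power2[of "cmod (of_real ?p - ?w)"] by linarith
  then have num: "(1 - ?p) * (norm (x - y))\<^sup>2
      \<le> (norm (x - y))\<^sup>2 - ((norm x * norm y)\<^sup>2 - (cmod ?w)\<^sup>2)"
    by (simp add: algebra_simps)
  have den: "(cmod (1 - ?w))\<^sup>2 \<le> 4" using assms by (intro one_minus_cinner_sq_le) auto
  have pos: "0 < (cmod (1 - ?w))\<^sup>2" using one_minus_cinner_pos[of x y] assms by auto
  have "0 \<le> (1 - ?p) * (norm (x - y))\<^sup>2" using one_minus_norm_sq_pos[OF assms(1)] by simp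
  then have "(1 - ?p) * (norm (x - y))\<^sup>2 / 4 \<le> (1 - ?p) * (norm (x - y))\<^sup>2 / (cmod (1 - ?w))\<^sup>2"
    using den pos by (intro divide_left_mono) auto
  also have "\<dots> \<le> 1 - hsigma x y"
    unfolding one_minus_hsigma[OF assms] by (intro divide_right_mono num) simp
  finally show ?thesis by simp
qed

lemma tendsto_hsigma:
  assumes "(u \<longlongrightarrow> x) F" "(v \<longlongrightarrow> y) F" "x \<in> ball 0 1" "y \<in> ball 0 (1::real)"
  shows "((\<lambda>k. hsigma (u k) (v k)) \<longlongrightarrow> hsigma x (y::'a::complex_inner)) F"
  unfolding hsigma_def
  by (intro tendsto_intros assms tendsto_cinner) (use one_minus_cinner_pos[of x y] assms in auto)


section \<open>The Schwarz-Pick inequality in the unit ball\<close>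

text \<open>The Schwarz lemma asks for a strict bound, so it is applied to \<open>h / k'\<close> with
  \<open>k' > k\<close>, precomposed with the disc automorphism that takes 0 to \<open>a\<close>.\<close>

lemma scalar_Schwarz_Pick:
  assumes hol: "h holomorphic_on ball 0 1" and h0: "h a = 0" and a: "cmod a < 1"
    and bd: "\<And>z. cmod z < 1 \<Longrightarrow> cmod (h z) \<le> k" and z: "cmod z < 1"
  shows "cmod (h z) \<le> k * cmod ((z - a) / (1 - cnj a * z))"
proof -
  let ?r = "cmod ((z - a) / (1 - cnj a * z))"
  have nz: "1 + cnj a * w \<noteq> 0" "1 - cnj a * w \<noteq> 0" if "cmod w < 1" for w
  proof -
    have "cmod (cnj a * w) < 1"
      using a that mult_strict_mono'[of "cmod a" 1 "cmod w" 1] by (simp add: norm_mult)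
    then have "cnj a * w \<noteq> 1" "cnj a * w \<noteq> -1" by (metis norm_minus_cancel norm_one less_irrefl)+
    then show "1 + cnj a * w \<noteq> 0" "1 - cnj a * w \<noteq> 0"
      by (simp_all add: add_eq_0_iff minus_equation_iff[of 1])
  qed
  have id: "(cmod (1 + cnj a * w))\<^sup>2 - (cmod (w + a))\<^sup>2 = (1 - (cmod a)\<^sup>2) * (1 - (cmod w)\<^sup>2)"
    for w unfolding cmod_power2 by (simp add: power2_eq_square algebra_simps)
  have asq: "1 - (cmod a)\<^sup>2 > 0" using a by (simp add: power_less_one_iff abs_square_less_1)
  have inball: "cmod ((w + a) / (1 + cnj a * w)) < 1" if "cmod w < 1" for w
  proof -
    have "0 < (1 - (cmod a)\<^sup>2) * (1 - (cmod w)\<^sup>2)"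
      using asq that by (simp add: power_less_one_iff abs_square_less_1)
    then have "(cmod (w + a))\<^sup>2 < (cmod (1 + cnj a * w))\<^sup>2" using id[of w] by simp
    then have "cmod (w + a) < cmod (1 + cnj a * w)"
      by (rule power2_less_imp_less) simp
    then show ?thesis using nz[OF that] by (simp add: norm_divide)
  qed
  have r1: "?r < 1"
  proof -
    have "(cmod (1 - cnj a * z))\<^sup>2 - (cmod (z - a))\<^sup>2 = (1 - (cmod a)\<^sup>2) * (1 - (cmod z)\<^sup>2)"
      unfolding cmod_power2 by (simp add: power2_eq_square algebra_simps)
    moreover have "0 < (1 - (cmod a)\<^sup>2) * (1 - (cmod z)\<^sup>2)"
      using asq z by (simp add: power_less_one_iff abs_square_less_1)
    ultimately have "cmod (z - a) < cmod (1 - cnj a * z)"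
      by (simp add: power2_less_imp_less)
    then show ?thesis using nz[OF z] by (simp add: norm_divide)
  qed
  have k0: "0 \<le> k" using bd[of 0] norm_ge_zero[of "h 0"] by (simp del: norm_ge_zero)
  have strict: "cmod (h z) \<le> k' * ?r" if k': "k < k'" for k'
  proof -
    have k'0: "0 < k'" using k0 k' by simp
    define g where "g = (\<lambda>w. h ((w + a) / (1 + cnj a * w)) / of_real k')"
    have "g holomorphic_on ball 0 1" unfolding g_def
    proof (intro holomorphic_intros holomorphic_on_compose_gen[OF _ hol, unfolded o_def])
      show "(\<lambda>w. (w + a) / (1 + cnj a * w)) ` ball 0 1 \<subseteq> ball 0 1"
        using inball by (auto simp: dist_norm)
    qed (use nz k'0 in \<open>auto simp: dist_norm\<close>)
    moreover have "g 0 = 0" by (simp add: g_def h0)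
    moreover have "cmod (g w) < 1" if "cmod w < 1" for w
      using bd[OF inball[OF that]] k' k'0 by (simp add: g_def norm_divide)
    ultimately have "cmod (g ((z - a) / (1 - cnj a * z))) \<le> ?r"
      using r1 by (intro Schwarz_Lemma(1)) auto
    moreover have "((z - a) / (1 - cnj a * z) + a) / (1 + cnj a * ((z - a) / (1 - cnj a * z))) = z"
    proof -
      have d: "1 - cnj a * a \<noteq> 0" "1 - cnj a * z \<noteq> 0" using nz[OF a] nz[OF z] by auto
      have "(z - a) / (1 - cnj a * z) + a = z * (1 - cnj a * a) / (1 - cnj a * z)"
        using d by (simp add: field_simps)
      moreover have "1 + cnj a * ((z - a) / (1 - cnj a * z)) = (1 - cnj a * a) / (1 - cnj a * z)"
        using d by (simp add: field_simps)
      ultimately show ?thesis using d by simp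
    qed
    ultimately show ?thesis using k'0 by (simp add: g_def norm_divide field_simps)
  qed
  show ?thesis
  proof (rule field_le_epsilon)
    fix e :: real assume e: "0 < e"
    have "cmod (h z) \<le> (k + e) * ?r" using strict[of "k + e"] e by simp
    also have "\<dots> \<le> k * ?r + e" using r1 e by (simp add: distrib_right)
    finally show "cmod (h z) \<le> k * ?r + e" .
  qed
qed

text \<open>The centre \<open>c\<close> of the disc is the point of the complex line closest to the origin; the
  disc has radius \<open>sqrt (1 - |c|\<^sup>2)\<close>, which is the norm of \<open>e\<close>.\<close>

lemma affine_disc_through:
  fixes v x :: "'a::complex_inner"
  assumes v: "v \<in> ball 0 1" and x: "x \<in> ball 0 1" and "x \<noteq> v"
  obtains c e \<mu> \<nu> where "v = c + \<mu> *\<^sub>C e" "x = c + \<nu> *\<^sub>C e" "cmod \<mu> < 1" "cmod \<nu> < 1"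
    "cinner c e = 0" "(norm c)\<^sup>2 + (norm e)\<^sup>2 = 1" "e \<noteq> 0"
proof -
  define u where "u = (1 / norm (x - v)) *\<^sub>R (x - v)"
  have d: "norm (x - v) > 0" using assms by simp
  have u1: "norm u = 1" using d by (simp add: u_def)
  then have uu: "cinner u u = 1" by (simp add: cinner_self)
  define c where "c = v - cinner v u *\<^sub>C u"
  have cu: "cinner c u = 0"
    by (simp add: c_def cinner_diff_left cinner_scaleC_left uu)
  have py: "(norm (c + \<xi> *\<^sub>C u))\<^sup>2 = (norm c)\<^sup>2 + (cmod \<xi>)\<^sup>2" for \<xi> :: complex
    by (simp add: norm_add_sq cinner_scaleC_right cu norm_scaleC u1)
  have v': "v = c + cinner v u *\<^sub>C u" by (simp add: c_def)
  have "(norm v)\<^sup>2 < 1" "(norm x)\<^sup>2 < 1"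
    using one_minus_norm_sq_pos[OF v] one_minus_norm_sq_pos[OF x] by auto
  have "(norm v)\<^sup>2 = (norm c)\<^sup>2 + (cmod (cinner v u))\<^sup>2"
    using py[of "cinner v u"] unfolding v'[symmetric] .
  then have c1: "(norm c)\<^sup>2 < 1"
    using \<open>(norm v)\<^sup>2 < 1\<close> zero_le_power2[of "cmod (cinner v u)"] by linarith
  define m where "m = sqrt (1 - (norm c)\<^sup>2)"
  have m: "m > 0" "m\<^sup>2 = 1 - (norm c)\<^sup>2" using c1 by (simp_all add: m_def)
  have xu: "x = c + (cinner v u + norm (x - v)) *\<^sub>C u"
  proof -
    have "c + (cinner v u + norm (x - v)) *\<^sub>C u = v + complex_of_real (norm (x - v)) *\<^sub>C u"
      unfolding scaleC_add_left add.assoc[symmetric] v'[symmetric] ..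
    also have "\<dots> = x" using d by (simp add: u_def scaleR_scaleC[symmetric])
    finally show ?thesis by simp
  qed
  have small: "cmod (\<xi> / m) < 1" if "(norm (c + \<xi> *\<^sub>C u))\<^sup>2 < 1" for \<xi> :: complex
  proof -
    have "(cmod \<xi>)\<^sup>2 < m\<^sup>2" using that py[of \<xi>] m by simp
    then have "cmod \<xi> < m" by (rule power2_less_imp_less) (use m in simp)
    then show ?thesis using m by (simp add: norm_divide)
  qed
  have sc: "(\<xi> / m) *\<^sub>C (m *\<^sub>R u) = \<xi> *\<^sub>C u" for \<xi> :: complex
    using m by (simp add: scaleR_scaleC scaleC_scaleC)
  show thesis
  proof (rule that[of c "cinner v u / m" "m *\<^sub>R u" "(cinner v u + norm (x - v)) / m"])
    show "v = c + (cinner v u / m) *\<^sub>C m *\<^sub>R u" unfolding sc by (rule v')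
    show "x = c + ((cinner v u + norm (x - v)) / m) *\<^sub>C m *\<^sub>R u" unfolding sc by (rule xu)
    show "cmod (cinner v u / m) < 1" using small[of "cinner v u"] \<open>(norm v)\<^sup>2 < 1\<close>
      unfolding v'[symmetric] by blast
    show "cmod ((cinner v u + norm (x - v)) / m) < 1"
      using small[of "cinner v u + norm (x - v)"] \<open>(norm x)\<^sup>2 < 1\<close>
      unfolding xu[symmetric] by blast
    show "cinner c (m *\<^sub>R u) = 0" by (simp add: cinner_scaleR_right cu)
    show "(norm c)\<^sup>2 + (norm (m *\<^sub>R u))\<^sup>2 = 1" using m u1 by (simp add: power_mult_distrib)
    show "m *\<^sub>R u \<noteq> 0" using m u1 by auto
  qed
qed

lemma affine_disc_in_ball:
  assumes "cinner c e = 0" "(norm c)\<^sup>2 + (norm e)\<^sup>2 = 1" "e \<noteq> 0" "cmod \<mu> < 1"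
  shows "c + \<mu> *\<^sub>C (e::'a::complex_inner) \<in> ball 0 1"
proof -
  have "(norm (c + \<mu> *\<^sub>C e))\<^sup>2 = (norm c)\<^sup>2 + (cmod \<mu>)\<^sup>2 * (norm e)\<^sup>2"
    by (simp add: norm_add_sq cinner_scaleC_right assms norm_scaleC power_mult_distrib)
  also have "\<dots> < (norm c)\<^sup>2 + 1 * (norm e)\<^sup>2"
    using assms by (intro add_strict_left_mono mult_strict_right_mono)
      (auto simp: power_less_one_iff abs_square_less_1)
  finally show ?thesis using assms(2) by (simp add: abs_square_less_1)
qed

text \<open>Orthogonality of \<open>c\<close> and \<open>e\<close> makes the factor \<open>|e|\<^sup>2\<close> split off from
  \<open>1 - <c + \<nu>e, c + \<mu>e>\<close> and from both \<open>1 - |c + \<nu>e|\<^sup>2\<close> and \<open>1 - |c + \<mu>e|\<^sup>2\<close>, so it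
  cancels.\<close>

lemma one_minus_hsigma_affine_disc:
  assumes "cinner c e = 0" "(norm c)\<^sup>2 + (norm e)\<^sup>2 = 1" "e \<noteq> 0"
    and \<mu>: "cmod \<mu> < 1" and \<nu>: "cmod \<nu> < 1"
  shows "1 - hsigma (c + \<nu> *\<^sub>C e) (c + \<mu> *\<^sub>C (e::'a::complex_inner))
      = (cmod ((\<nu> - \<mu>) / (1 - cnj \<mu> * \<nu>)))\<^sup>2"
proof -
  let ?E = "(norm e)\<^sup>2"
  have ec: "cinner e c = 0" using assms(1) cinner_commute[of e c] by simp
  have E: "?E \<noteq> 0" using assms(3) by simp
  have C: "(norm c)\<^sup>2 = 1 - ?E" using assms(2) by simp
  have n: "1 - (norm (c + \<xi> *\<^sub>C e))\<^sup>2 = ?E * (1 - (cmod \<xi>)\<^sup>2)" for \<xi>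
    by (simp add: norm_add_sq cinner_scaleC_right assms(1) C norm_scaleC power_mult_distrib
        algebra_simps)
  have "1 - cinner (c + \<nu> *\<^sub>C e) (c + \<mu> *\<^sub>C e) = of_real ?E * (1 - cnj \<mu> * \<nu>)"
    by (simp add: cinner_add_left cinner_add_right cinner_scaleC_left cinner_scaleC_right
        assms(1) ec cinner_self C algebra_simps)
  then have w: "cmod (1 - cinner (c + \<nu> *\<^sub>C e) (c + \<mu> *\<^sub>C e)) = ?E * cmod (1 - cnj \<mu> * \<nu>)"
    by (simp add: norm_mult norm_power)
  have "cmod (cnj \<mu> * \<nu>) < 1"
    using \<mu> \<nu> mult_strict_mono'[of "cmod \<mu>" 1 "cmod \<nu>" 1] by (simp add: norm_mult)
  then have nz: "(cmod (1 - cnj \<mu> * \<nu>))\<^sup>2 \<noteq> 0" by auto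
  have id: "(cmod (1 - cnj \<mu> * \<nu>))\<^sup>2 - (cmod (\<nu> - \<mu>))\<^sup>2 = (1 - (cmod \<mu>)\<^sup>2) * (1 - (cmod \<nu>)\<^sup>2)"
    unfolding cmod_power2 by (simp add: power2_eq_square algebra_simps)
  have "hsigma (c + \<nu> *\<^sub>C e) (c + \<mu> *\<^sub>C e)
      = (1 - (cmod \<mu>)\<^sup>2) * (1 - (cmod \<nu>)\<^sup>2) / (cmod (1 - cnj \<mu> * \<nu>))\<^sup>2"
  proof -
    have "(E * A) * (E * B) / (E * C)\<^sup>2 = B * A / C\<^sup>2" if "E \<noteq> 0" for E A B C :: real
      using that by (simp add: power2_eq_square)
    then show ?thesis unfolding hsigma_def n w using E by blast
  qed
  also have "1 - \<dots> = (cmod (\<nu> - \<mu>))\<^sup>2 / (cmod (1 - cnj \<mu> * \<nu>))\<^sup>2"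
    using nz id[symmetric] by (simp add: field_simps)
  finally show ?thesis by (simp add: norm_divide power_divide)
qed

lemma holomorphic_on_cinner_affine_disc:
  fixes f :: "'a::complex_inner \<Rightarrow> 'b::complex_inner"
  assumes hol: "holomorphic_map_on f (ball 0 1)"
    and disc: "\<And>\<mu>. cmod \<mu> < 1 \<Longrightarrow> c + \<mu> *\<^sub>C e \<in> ball 0 1"
  shows "(\<lambda>\<mu>. cinner (f (c + \<mu> *\<^sub>C e)) b) holomorphic_on ball 0 1"
proof (rule holomorphic_onI)
  fix \<mu> :: complex assume "\<mu> \<in> ball 0 1"
  then have in_ball: "c + \<mu> *\<^sub>C e \<in> ball 0 1" using disc by simp
  then obtain f' where f': "(f has_derivative f') (at (c + \<mu> *\<^sub>C e))"
    and lin: "\<And>d v. f' (d *\<^sub>C v) = d *\<^sub>C f' v"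
    using hol unfolding holomorphic_map_on_def by (metis at_within_open open_ball)
  have "((\<lambda>\<mu>. c + \<mu> *\<^sub>C e) has_derivative (\<lambda>h. 0 + h *\<^sub>C e)) (at \<mu>)"
    by (intro has_derivative_add has_derivative_const
        bounded_linear.has_derivative[OF bounded_linear_scaleC_left] has_derivative_ident)
  from has_derivative_compose[OF this f']
  have "((\<lambda>\<mu>. f (c + \<mu> *\<^sub>C e)) has_derivative (\<lambda>h. f' (h *\<^sub>C e))) (at \<mu>)" by simp
  from bounded_linear.has_derivative[OF bounded_bilinear.bounded_linear_left
      [OF bounded_bilinear_cinner, of b] this]
  have "((\<lambda>\<mu>. cinner (f (c + \<mu> *\<^sub>C e)) b) has_derivative (\<lambda>h. cinner (f' e) b * h)) (at \<mu>)"
    by (simp add: lin cinner_scaleC_left mult.commute)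
  then have "((\<lambda>\<mu>. cinner (f (c + \<mu> *\<^sub>C e)) b) has_field_derivative cinner (f' e) b) (at \<mu>)"
    by (simp add: has_field_derivative_def)
  then show "(\<lambda>\<mu>. cinner (f (c + \<mu> *\<^sub>C e)) b) field_differentiable at \<mu> within ball 0 1"
    using field_differentiable_at_within field_differentiable_def by blast
qed

text \<open>This is the involutive automorphism of the ball that exchanges 0 and \<open>a\<close>. In the usual
  formula \<open>(a - P z - s Q z) / (1 - <z,a>)\<close>, where \<open>P\<close> projects onto the line of \<open>a\<close> and
  \<open>Q = 1 - P\<close>, the coefficient \<open>(1 - s) / |a|\<^sup>2\<close> has been rewritten as \<open>1 / (1 + s)\<close>, which
  makes sense for \<open>a = 0\<close> as well.\<close>

definition moebius :: "'a::complex_inner \<Rightarrow> 'a \<Rightarrow> 'a" where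
  "moebius a z = (let s = sqrt (1 - (norm a)\<^sup>2); w = cinner z a
     in (1 / (1 - w)) *\<^sub>C ((1 - w / (1 + s)) *\<^sub>C a - s *\<^sub>R z))"

lemma norm_moebius_sq:
  assumes a: "a \<in> ball 0 1" and z: "z \<in> ball 0 1"
  shows "(norm (moebius a z))\<^sup>2 = 1 - hsigma z (a::'a::complex_inner)"
proof -
  define s where "s = sqrt (1 - (norm a)\<^sup>2)"
  define w where "w = cinner z a"
  define q where "q = 1 - w / (1 + s)"
  have s: "s > 0" "(norm a)\<^sup>2 = 1 - s\<^sup>2" using one_minus_norm_sq_pos[OF a] by (simp_all add: s_def)
  have w: "cmod (1 - w) > 0" unfolding w_def using one_minus_cinner_pos[of z a] a z by simp
  have qR: "Re q = 1 - Re w / (1 + s)" "Im q = - Im w / (1 + s)"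
    using Re_divide_of_real[of w "1 + s"] Im_divide_of_real[of w "1 + s"] by (simp_all add: q_def)
  have "(norm (q *\<^sub>C a - s *\<^sub>R z))\<^sup>2
      = (cmod q)\<^sup>2 * (norm a)\<^sup>2 + s\<^sup>2 * (norm z)\<^sup>2 - 2 * s * Re (q * cnj w)"
    unfolding norm_diff_sq norm_scaleC
    by (simp add: cinner_scaleC_left cinner_scaleR_right power_mult_distrib w_def
        cinner_commute[of a z] algebra_simps)
  also have "\<dots> = (cmod (1 - w))\<^sup>2 - s\<^sup>2 * (1 - (norm z)\<^sup>2)"
  proof -
    define t where "t = 1 / (1 + s)"
    have t: "t * (1 + s) = 1" using s by (simp add: t_def)
    have "Re q = 1 - t * Re w" "Im q = - t * Im w" by (simp_all add: qR t_def)
    then have "(cmod q)\<^sup>2 = (1 - t * Re w)\<^sup>2 + (t * Im w)\<^sup>2"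
      "Re (q * cnj w) = (1 - t * Re w) * Re w - t * Im w * Im w"
      by (simp_all add: cmod_power2)
    moreover have "(cmod (1 - w))\<^sup>2 = (1 - Re w)\<^sup>2 + (Im w)\<^sup>2" by (simp add: cmod_power2)
    moreover have "((1 - t * x)\<^sup>2 + (t * y)\<^sup>2) * (1 - s\<^sup>2) + s\<^sup>2 * n
        - 2 * s * ((1 - t * x) * x - t * y * y) = (1 - x)\<^sup>2 + y\<^sup>2 - s\<^sup>2 * (1 - n)" for x y n :: real
    proof -
      have "((1 - t * x)\<^sup>2 + (t * y)\<^sup>2) * (1 - s\<^sup>2)
          = 1 - s\<^sup>2 - 2 * x * (1 - s) * (t * (1 + s)) + t * (1 - s) * (x\<^sup>2 + y\<^sup>2) * (t * (1 + s))"
        by (simp add: power2_eq_square algebra_simps)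
      also have "\<dots> = 1 - s\<^sup>2 - 2 * x + 2 * s * x + t * (1 - s) * (x\<^sup>2 + y\<^sup>2)"
        unfolding t by (simp add: algebra_simps)
      finally have e1: "((1 - t * x)\<^sup>2 + (t * y)\<^sup>2) * (1 - s\<^sup>2)
          = 1 - s\<^sup>2 - 2 * x + 2 * s * x + t * (1 - s) * (x\<^sup>2 + y\<^sup>2)" .
      have e2: "2 * s * ((1 - t * x) * x - t * y * y) = 2 * s * x - 2 * s * t * (x\<^sup>2 + y\<^sup>2)"
        by (simp add: power2_eq_square algebra_simps)
      have "t * (1 - s) * (x\<^sup>2 + y\<^sup>2) + 2 * s * t * (x\<^sup>2 + y\<^sup>2) = (t * (1 + s)) * (x\<^sup>2 + y\<^sup>2)"
        by (simp add: algebra_simps)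
      then have e3: "t * (1 - s) * (x\<^sup>2 + y\<^sup>2) + 2 * s * t * (x\<^sup>2 + y\<^sup>2) = x\<^sup>2 + y\<^sup>2"
        unfolding t by simp
      have "(1 - x)\<^sup>2 + y\<^sup>2 - s\<^sup>2 * (1 - n) = 1 - 2 * x + (x\<^sup>2 + y\<^sup>2) - s\<^sup>2 + s\<^sup>2 * n"
        by (simp add: power2_eq_square algebra_simps)
      then show ?thesis unfolding e1 e2 using e3 by linarith
    qed
    ultimately show ?thesis by (simp only: s(2))
  qed
  finally have num: "(norm (q *\<^sub>C a - s *\<^sub>R z))\<^sup>2 = (cmod (1 - w))\<^sup>2 - s\<^sup>2 * (1 - (norm z)\<^sup>2)" .
  have "(norm (moebius a z))\<^sup>2 = (norm (q *\<^sub>C a - s *\<^sub>R z))\<^sup>2 / (cmod (1 - w))\<^sup>2"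
    unfolding moebius_def Let_def w_def[symmetric] s_def[symmetric]
    by (simp add: q_def norm_scaleC norm_divide power_divide)
  also have "\<dots> = 1 - hsigma z a"
    unfolding num hsigma_def w_def[symmetric] s(2) using w by (simp add: diff_divide_distrib mult.commute)
  finally show ?thesis .
qed

text \<open>The inequality is reduced to the Schwarz lemma of one variable. The points \<open>v\<close> and \<open>x\<close>
  lie on the intersection of a complex line with the ball, which is a disc on which \<open>hsigma\<close>
  is the one-dimensional invariant. On the target side, a Moebius map sends \<open>f v\<close> to 0, and pairing
  with the image of \<open>f x\<close> gives a scalar function. The factor \<open>k\<close> is kept because a map whose
  range is well inside the ball satisfies the hypothesis with \<open>k < 1\<close> and is then a
  strict contraction.\<close>

theorem Schwarz_Pick_ball:
  fixes f :: "'a::complex_inner \<Rightarrow> 'a"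
  assumes hol: "holomorphic_map_on f (ball 0 1)" and into: "f ` ball 0 1 \<subseteq> ball 0 1"
    and k: "0 \<le> k" and bd: "\<And>z. z \<in> ball 0 1 \<Longrightarrow> 1 - hsigma (f z) (f v) \<le> k\<^sup>2"
    and v: "v \<in> ball 0 1" and x: "x \<in> ball 0 1"
  shows "1 - hsigma (f x) (f v) \<le> k\<^sup>2 * (1 - hsigma x v)"
proof (cases "x = v")
  case True
  then show ?thesis using v into hsigma_self[of v] hsigma_self[of "f v"] by (force simp: image_subset_iff)
next
  case False
  then obtain c e \<mu> \<nu> where ce: "v = c + \<mu> *\<^sub>C e" "x = c + \<nu> *\<^sub>C e" and \<mu>\<nu>: "cmod \<mu> < 1" "cmod \<nu> < 1"
    and perp: "cinner c e = 0" "(norm c)\<^sup>2 + (norm e)\<^sup>2 = 1" "e \<noteq> 0"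
    by (rule affine_disc_through[OF v x])
  have disc: "c + \<xi> *\<^sub>C e \<in> ball 0 1" if "cmod \<xi> < 1" for \<xi>
    using affine_disc_in_ball[OF perp that] .
  define a where "a = f v"
  have a: "a \<in> ball 0 1" and fin: "\<And>z. z \<in> ball 0 1 \<Longrightarrow> f z \<in> ball 0 1"
    unfolding a_def using into v by blast+
  define s where "s = sqrt (1 - (norm a)\<^sup>2)"
  define G where "G = moebius a"
  define b where "b = G (f x)"
  define h where "h = (\<lambda>\<xi>. cinner (G (f (c + \<xi> *\<^sub>C e))) b)"
  have nG: "(norm (G (f z)))\<^sup>2 = 1 - hsigma (f z) a" if "z \<in> ball 0 1" for z
    unfolding G_def using norm_moebius_sq[OF a fin[OF that]] .
  have h_eq: "h = (\<lambda>\<xi>. (1 / (1 - cinner (f (c + \<xi> *\<^sub>C e)) a)) *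
      ((1 - cinner (f (c + \<xi> *\<^sub>C e)) a / (1 + of_real s)) * cinner a b - s * cinner (f (c + \<xi> *\<^sub>C e)) b))"
    unfolding h_def G_def moebius_def Let_def s_def[symmetric]
    by (simp add: cinner_scaleC_left cinner_diff_left cinner_scaleR_left)
  have "s > 0" using one_minus_norm_sq_pos[OF a] by (simp add: s_def)
  then have s1: "1 + complex_of_real s \<noteq> 0"
    by (auto simp: complex_eq_iff)
  have nz: "1 - cinner (f (c + \<xi> *\<^sub>C e)) a \<noteq> 0" if "\<xi> \<in> ball 0 1" for \<xi>
    using one_minus_cinner_pos[OF fin[OF disc[of \<xi>]], of a] that a by simp
  note F = holomorphic_on_cinner_affine_disc[OF hol disc]
  have "h holomorphic_on ball 0 1" unfolding h_eq
    by (intro holomorphic_on_mult holomorphic_on_divide holomorphic_on_diff holomorphic_on_const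
        F nz s1)
  moreover have "h \<mu> = 0"
  proof -
    have "(norm (G (f v)))\<^sup>2 = 0"
      using nG[OF v] hsigma_self[OF a] by (simp add: a_def)
    then show ?thesis unfolding h_def ce(1)[symmetric]
      by (simp add: bounded_bilinear.zero_left[OF bounded_bilinear_cinner])
  qed
  moreover have "cmod (h \<xi>) \<le> k * norm b" if "cmod \<xi> < 1" for \<xi>
  proof -
    have "(norm (G (f (c + \<xi> *\<^sub>C e))))\<^sup>2 \<le> k\<^sup>2"
      using nG[OF disc[OF that]] bd[OF disc[OF that]] by (simp add: a_def)
    then have "norm (G (f (c + \<xi> *\<^sub>C e))) \<le> k" using k by (rule power2_le_imp_le)
    then show ?thesis unfolding h_def
      by (intro order_trans[OF cinner_Cauchy_Schwarz] mult_right_mono) auto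
  qed
  ultimately have "cmod (h \<nu>) \<le> k * norm b * cmod ((\<nu> - \<mu>) / (1 - cnj \<mu> * \<nu>))"
    using \<mu>\<nu> by (intro scalar_Schwarz_Pick)
  moreover have "cmod (h \<nu>) = norm b * norm b"
    unfolding h_def ce(2)[symmetric] b_def[symmetric] cinner_self norm_of_real
    by (simp add: power2_eq_square)
  ultimately have "norm b \<le> k * cmod ((\<nu> - \<mu>) / (1 - cnj \<mu> * \<nu>))"
    using k mult_right_le_imp_le[of "norm b" "norm b" "k * cmod ((\<nu> - \<mu>) / (1 - cnj \<mu> * \<nu>))"]
    by (cases "b = 0") (simp_all add: ac_simps)
  then have "(norm b)\<^sup>2 \<le> (k * cmod ((\<nu> - \<mu>) / (1 - cnj \<mu> * \<nu>)))\<^sup>2"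
    by (rule power_mono) simp
  then show ?thesis
    unfolding power_mult_distrib one_minus_hsigma_affine_disc[OF perp \<mu>\<nu>, symmetric]
      ce[symmetric] b_def nG[OF x] a_def .
qed

lemma hsigma_le_1:
  assumes "x \<in> ball 0 1" "y \<in> ball 0 1" shows "hsigma x (y::'a::complex_inner) \<le> 1"
proof -
  have "0 \<le> (1 - (norm x)\<^sup>2) * (norm (x - y))\<^sup>2" using one_minus_norm_sq_pos[OF assms(1)] by simp
  from order_trans[OF this norm_diff_sq_le_hsigma[OF assms]] show ?thesis by simp
qed

text \<open>On a smaller concentric ball the pseudo-hyperbolic distance stays below a constant less
  than 1; this produces the contraction factor of \<open>t f\<close>.\<close>

lemma hsigma_lower:
  assumes "norm x \<le> t" "norm y \<le> t" "t < 1"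
  shows "(1 - t\<^sup>2)\<^sup>2 / 4 \<le> hsigma x (y::'a::complex_inner)"
proof -
  have xy: "x \<in> ball 0 1" "y \<in> ball 0 1" using assms by auto
  have t: "0 \<le> t" using assms(1) norm_ge_zero[of x] by linarith
  then have t2: "t\<^sup>2 < 1" using assms by (simp add: power_less_one_iff)
  have den: "(cmod (1 - cinner x y))\<^sup>2 \<le> 4" using xy by (intro one_minus_cinner_sq_le) auto
  have pos: "0 < cmod (1 - cinner x y)" using one_minus_cinner_pos[of x y] xy by auto
  have "(norm x)\<^sup>2 \<le> t\<^sup>2" "(norm y)\<^sup>2 \<le> t\<^sup>2" using assms by (auto intro!: power_mono)
  then have "(1 - t\<^sup>2) * (1 - t\<^sup>2) \<le> (1 - (norm x)\<^sup>2) * (1 - (norm y)\<^sup>2)"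
    using t2 by (intro mult_mono) auto
  then show ?thesis unfolding hsigma_def power2_eq_square[of "1 - t\<^sup>2"]
    using den pos one_minus_norm_sq_pos[OF xy(1)] one_minus_norm_sq_pos[OF xy(2)]
    by (intro frac_le) auto
qed

text \<open>A point at bounded hyperbolic distance from \<open>u\<close> stays away from the sphere.\<close>

lemma one_minus_norm_sq_ge_hsigma:
  assumes "z \<in> ball 0 1" "u \<in> ball 0 1" "s \<le> hsigma z u" "0 \<le> s"
  shows "s * (1 - norm u)\<^sup>2 \<le> 1 - (norm (z::'a::complex_inner))\<^sup>2"
proof -
  let ?d = "cmod (1 - cinner z u)"
  have pos: "0 < ?d" using one_minus_cinner_pos[of z u] assms by auto
  have "1 - norm u \<le> 1 - norm z * norm u"
    using mult_left_le_one_le[of "norm u" "norm z"] assms by simp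
  then have "1 - norm u \<le> ?d" using one_minus_cinner_lower[of z u] by linarith
  then have "(1 - norm u)\<^sup>2 \<le> ?d\<^sup>2" using assms by (intro power_mono) auto
  then have "s * (1 - norm u)\<^sup>2 \<le> s * ?d\<^sup>2" using assms by (intro mult_left_mono) auto
  also have "\<dots> \<le> hsigma z u * ?d\<^sup>2" using assms by (intro mult_right_mono) auto
  also have "\<dots> = (1 - (norm z)\<^sup>2) * (1 - (norm u)\<^sup>2)" unfolding hsigma_def using pos by simp
  also have "\<dots> \<le> 1 - (norm z)\<^sup>2"
    using one_minus_norm_sq_pos[OF assms(1)] by (intro mult_left_le) auto
  finally show ?thesis .
qed

lemma close_imp_hsigma_ge:
  assumes "(norm a)\<^sup>2 \<le> 1 - c" "(norm b)\<^sup>2 \<le> 1 - c" "0 < c" "norm (a - b) < c / 2"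
  shows "3 / 4 \<le> hsigma a (b::'a::complex_inner)"
proof -
  have ab: "a \<in> ball 0 1" "b \<in> ball 0 1"
    using assms abs_square_less_1[of "norm a"] abs_square_less_1[of "norm b"] by auto
  define m where "m = norm a * norm b"
  have "2 * m \<le> (norm a)\<^sup>2 + (norm b)\<^sup>2"
    unfolding m_def using sum_squares_bound[of "norm a" "norm b"] by (simp add: mult.assoc)
  then have "c \<le> 1 - m" using assms(1,2) by linarith
  then have d: "c \<le> cmod (1 - cinner a b)"
    using one_minus_cinner_lower[of a b] unfolding m_def by linarith
  have "(norm (a - b))\<^sup>2 / (cmod (1 - cinner a b))\<^sup>2 \<le> (c / 2)\<^sup>2 / c\<^sup>2"
    using assms d by (intro frac_le power_mono) auto
  also have "\<dots> = 1 / 4" using assms by (simp add: power2_eq_square)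
  finally show ?thesis using one_minus_hsigma_upper[OF ab] by linarith
qed


section \<open>Approximating fixed points\<close>

text \<open>If \<open>W < P\<close>, the first hypothesis puts \<open>W\<close> above \<open>Q\<close>, and since \<open>P\<close> carries the larger
  weight, \<open>W\<close> is at least the arithmetic mean of \<open>P\<close> and \<open>Q\<close>. By hypothesis it is at most their
  geometric mean, so \<open>P\<close> and \<open>Q\<close> would be equal.\<close>

lemma weighted_mean_bound:
  fixes P Q W \<alpha> \<beta> :: real
  assumes "\<alpha> * (P - W) + \<beta> * (Q - W) \<le> 0" "0 < \<beta>" "\<beta> \<le> \<alpha>" "W\<^sup>2 \<le> P * Q" "0 < P" "0 < Q"
  shows "P \<le> W"
proof (rule ccontr)
  assume "\<not> P \<le> W"
  then have W: "W < P" by simp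
  have "0 < \<alpha> * (P - W)" using assms W by simp
  then have "\<beta> * (Q - W) < 0" using assms(1) by linarith
  then have QW: "Q < W" using assms(2) by (simp add: mult_less_0_iff)
  have "\<beta> * (P - W) \<le> \<alpha> * (P - W)" using assms W by (intro mult_right_mono) auto
  then have "\<beta> * (P + Q - 2 * W) \<le> 0" using assms(1) by (simp add: algebra_simps)
  then have "P + Q \<le> 2 * W" using assms(2) by (simp add: mult_le_0_iff)
  then have "(P + Q)\<^sup>2 \<le> (2 * W)\<^sup>2" using assms by (intro power_mono) auto
  also have "\<dots> \<le> 4 * (P * Q)" using assms(4) by (simp add: power_mult_distrib)
  finally have "(P - Q)\<^sup>2 \<le> 0" by (simp add: power2_eq_square algebra_simps)
  then have "P = Q" by simp
  then show False using W QW by simp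
qed

locale ball_self_map =
  fixes f :: "'a::complex_hilbert_space \<Rightarrow> 'a"
  assumes hol: "holomorphic_map_on f (ball 0 1)"
    and into: "z \<in> ball 0 1 \<Longrightarrow> f z \<in> ball 0 1"
begin

lemma hsigma_nonexpansive:
  assumes "x \<in> ball 0 1" "y \<in> ball 0 1"
  shows "hsigma x y \<le> hsigma (f x) (f y)"
proof -
  have "1 - hsigma (f x) (f y) \<le> 1\<^sup>2 * (1 - hsigma x y)"
    by (rule Schwarz_Pick_ball[OF hol])
       (use assms into hsigma_pos[OF into into] in \<open>auto simp: less_imp_le simp del: mem_ball\<close>)
  then show ?thesis by simp
qed

lemma iterate_into: "z \<in> ball 0 1 \<Longrightarrow> (f ^^ n) z \<in> ball 0 1"
  by (induction n) (use into in \<open>auto simp del: mem_ball\<close>)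

lemma hsigma_iterate:
  "x \<in> ball 0 1 \<Longrightarrow> y \<in> ball 0 1 \<Longrightarrow> hsigma x y \<le> hsigma ((f ^^ n) x) ((f ^^ n) y)"
proof (induction n)
  case (Suc n)
  then show ?case
    using hsigma_nonexpansive[OF iterate_into iterate_into, of x y n n] by (auto simp del: mem_ball)
qed simp

lemma isCont_on_ball: "z \<in> ball 0 1 \<Longrightarrow> isCont f z"
  using hol unfolding holomorphic_map_on_def
  by (metis at_within_open has_derivative_continuous open_ball)

lemma isCont_iterate: "z \<in> ball 0 1 \<Longrightarrow> isCont (f ^^ n) z"
proof (induction n)
  case 0
  then show ?case by (simp add: id_def)
next
  case (Suc n)
  then have "isCont (f \<circ> (f ^^ n)) z"
    by (intro continuous_at_compose isCont_on_ball iterate_into) auto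
  then show ?case by (simp add: o_def)
qed

text \<open>The iterates of \<open>t f\<close> from 0 have geometrically decreasing pseudo-hyperbolic steps. They stay
  in the ball of radius \<open>t\<close>, where the pseudo-hyperbolic distance dominates a multiple of the norm
  distance, so they form a Cauchy sequence.\<close>

lemma ex_approximating_fixed_point:
  assumes t: "0 < t" "t < 1"
  shows "\<exists>x\<in>ball 0 1. t *\<^sub>R f x = x"
proof -
  define g where "g = (\<lambda>z. t *\<^sub>R f z)"
  have gt: "norm (g z) \<le> t" if "z \<in> ball 0 1" for z
    using into[OF that] t by (simp add: g_def mult_left_le)
  have gin: "g z \<in> ball 0 1" if "z \<in> ball 0 1" for z using gt[OF that] t by simp
  have ghol: "holomorphic_map_on g (ball 0 1)"
    unfolding holomorphic_map_on_def
  proof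
    fix x :: 'a assume "x \<in> ball 0 1"
    then obtain f' where f': "(f has_derivative f') (at x within ball 0 1)"
      and lin: "\<forall>c v. f' (c *\<^sub>C v) = c *\<^sub>C f' v"
      using hol unfolding holomorphic_map_on_def by blast
    show "\<exists>g'. (g has_derivative g') (at x within ball 0 1) \<and> (\<forall>c v. g' (c *\<^sub>C v) = c *\<^sub>C g' v)"
    proof (intro exI conjI allI)
      show "(g has_derivative (\<lambda>v. t *\<^sub>R f' v)) (at x within ball 0 1)"
        unfolding g_def by (intro has_derivative_scaleR_right f')
      show "t *\<^sub>R f' (c *\<^sub>C v) = c *\<^sub>C t *\<^sub>R f' v" for c v
        by (simp add: lin scaleR_scaleC scaleC_scaleC mult.commute)
    qed
  qed
  define k where "k = sqrt (1 - (1 - t\<^sup>2)\<^sup>2 / 4)"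
  have "t\<^sup>2 < 1" using t by (simp add: power_less_one_iff)
  then have "0 < (1 - t\<^sup>2)\<^sup>2" "(1 - t\<^sup>2)\<^sup>2 \<le> 1"
    by (simp_all add: power_le_one)
  then have k: "0 \<le> k" "k < 1" "k\<^sup>2 = 1 - (1 - t\<^sup>2)\<^sup>2 / 4"
    by (simp_all add: k_def real_less_lsqrt)
  have contr: "1 - hsigma (g x) (g y) \<le> k\<^sup>2 * (1 - hsigma x y)"
    if "x \<in> ball 0 1" "y \<in> ball 0 1" for x y
  proof (rule Schwarz_Pick_ball[OF ghol _ k(1) _ that(2,1)])
    show "g ` ball 0 1 \<subseteq> ball 0 1" using gin by blast
    show "1 - hsigma (g z) (g y) \<le> k\<^sup>2" if "z \<in> ball 0 1" for z
      using hsigma_lower[OF gt[OF that] gt[OF \<open>y \<in> ball 0 1\<close>] t(2)] k(3) by linarith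
  qed
  define u where "u n = (g ^^ n) 0" for n
  have uS: "u (Suc n) = g (u n)" for n by (simp add: u_def)
  have ut: "norm (u n) \<le> t" for n
  proof (induction n)
    case (Suc n)
    then show ?case using gt[of "u n"] t by (simp add: uS)
  qed (use t in \<open>simp add: u_def\<close>)
  have uin: "u n \<in> ball 0 1" for n using ut[of n] t by simp
  have step: "1 - hsigma (u n) (u (Suc n)) \<le> (k\<^sup>2) ^ n" for n
  proof (induction n)
    case 0
    then show ?case using hsigma_pos[OF uin[of 0] uin[of 1]] by simp
  next
    case (Suc n)
    have "1 - hsigma (u (Suc n)) (u (Suc (Suc n))) \<le> k\<^sup>2 * (1 - hsigma (u n) (u (Suc n)))"
      unfolding uS[of "Suc n"] uS[of n] using contr[OF uin[of n] uin[of "Suc n"]] by (simp add: uS)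
    also have "\<dots> \<le> k\<^sup>2 * (k\<^sup>2) ^ n" using Suc by (intro mult_left_mono) auto
    finally show ?case by simp
  qed
  define C where "C = 2 / sqrt (1 - t\<^sup>2)"
  have diff: "norm (u (Suc n) - u n) \<le> C * k ^ n" for n
  proof (rule power2_le_imp_le)
    have "(norm (u n))\<^sup>2 \<le> t\<^sup>2" using ut[of n] by (intro power_mono) auto
    then have "(1 - t\<^sup>2) * (norm (u n - u (Suc n)))\<^sup>2 \<le> (1 - (norm (u n))\<^sup>2) * (norm (u n - u (Suc n)))\<^sup>2"
      by (intro mult_right_mono) auto
    also have "\<dots> \<le> 4 * (1 - hsigma (u n) (u (Suc n)))" by (rule norm_diff_sq_le_hsigma[OF uin uin])
    also have "\<dots> \<le> 4 * (k\<^sup>2) ^ n" using step[of n] by simp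
    finally have "(norm (u n - u (Suc n)))\<^sup>2 \<le> 4 * (k\<^sup>2) ^ n / (1 - t\<^sup>2)"
      using \<open>t\<^sup>2 < 1\<close> by (simp add: field_simps)
    also have "\<dots> = (C * k ^ n)\<^sup>2"
      using \<open>t\<^sup>2 < 1\<close> by (simp add: C_def power_mult_distrib power_divide power_mult[symmetric] mult.commute)
    finally show "(norm (u (Suc n) - u n))\<^sup>2 \<le> (C * k ^ n)\<^sup>2" by (simp add: norm_minus_commute)
    show "0 \<le> C * k ^ n" using k \<open>t\<^sup>2 < 1\<close> by (simp add: C_def)
  qed
  have "summable (\<lambda>n. u (Suc n) - u n)"
    by (rule summable_comparison_test'[where N=0 and g="\<lambda>n. C * k ^ n"])
       (use diff k in \<open>auto intro!: summable_mult summable_geometric\<close>)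
  then have "(\<lambda>m. \<Sum>n<m. u (Suc n) - u n) \<longlonglongrightarrow> (\<Sum>n. u (Suc n) - u n)" by (rule summable_LIMSEQ)
  then have lim: "(\<lambda>m. u m) \<longlonglongrightarrow> (\<Sum>n. u (Suc n) - u n)"
    by (simp add: sum_lessThan_telescope u_def[of 0])
  define x where "x = (\<Sum>n. u (Suc n) - u n)"
  have "norm x \<le> t"
    by (rule LIMSEQ_le_const2[OF tendsto_norm[OF lim[folded x_def]]]) (use ut in auto)
  then have x: "x \<in> ball 0 1" using t by simp
  have "(\<lambda>m. g (u m)) \<longlonglongrightarrow> g x"
    unfolding g_def using isCont_tendsto_compose[OF isCont_on_ball[OF x] lim[folded x_def]]
    by (intro tendsto_scaleR tendsto_const)
  moreover have "(\<lambda>m. g (u m)) \<longlonglongrightarrow> x"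
    using LIMSEQ_Suc[OF lim[folded x_def]] by (simp add: uS)
  ultimately have "g x = x" by (rule LIMSEQ_unique)
  then show ?thesis using x by (auto simp: g_def)
qed

text \<open>The hyperbolic analogue of Browder's and Halpern's inequality for resolvents of nonexpansive
  maps. With \<open>P = 1/(1 - |x|\<^sup>2)\<close>, \<open>Q = 1/(1 - |y|\<^sup>2)\<close>, \<open>\<omega> = 1/(1 - <x,y>)\<close>, \<open>a = 1/s\<close> and
  \<open>b = 1/t\<close>, nonexpansiveness on \<open>x, y\<close> and their images \<open>a x, b y\<close> says that moving both points
  outward does not separate them. This linearizes without error terms to
  \<open>(a\<^sup>2 - 1)(P - Re \<omega>) + (b\<^sup>2 - 1)(Q - Re \<omega>) \<le> 0\<close>. Since \<open>a \<ge> b\<close> and \<open>|\<omega>|\<^sup>2 \<le> P Q\<close>, it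
  follows that \<open>Re \<omega> \<ge> P\<close>, hence \<open>|1 - <x,y>| \<le> 1 - |x|\<^sup>2\<close>, and that is the claim after
  expanding the norm of the difference.\<close>

lemma approximating_fixed_points_dist:
  assumes st: "0 < s" "s \<le> t" "t < 1"
    and x: "x \<in> ball 0 1" "s *\<^sub>R f x = x" and y: "y \<in> ball 0 1" "t *\<^sub>R f y = y"
  shows "(norm (x - y))\<^sup>2 \<le> (norm y)\<^sup>2 - (norm x)\<^sup>2"
proof -
  define a b p q w where "a = 1 / s" and "b = 1 / t" and "p = (norm x)\<^sup>2"
    and "q = (norm y)\<^sup>2" and "w = cinner x y"
  have ab: "1 < b" "b \<le> a" using st by (simp_all add: a_def b_def frac_le)
  have t0: "0 < t" using st by simp
  have "f x = (1 / s) *\<^sub>R (s *\<^sub>R f x)" using st by simp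
  then have fx: "f x = a *\<^sub>R x" unfolding x(2) a_def .
  have "f y = (1 / t) *\<^sub>R (t *\<^sub>R f y)" using t0 by simp
  then have fy: "f y = b *\<^sub>R y" unfolding y(2) b_def .
  have p: "p < 1" "0 \<le> p" and q: "q < 1" "0 \<le> q"
    using one_minus_norm_sq_pos[OF x(1)] one_minus_norm_sq_pos[OF y(1)] by (simp_all add: p_def q_def)
  have ap: "a\<^sup>2 * p < 1" and bq: "b\<^sup>2 * q < 1"
    using one_minus_norm_sq_pos[OF into[OF x(1)]] one_minus_norm_sq_pos[OF into[OF y(1)]]
    by (simp_all add: fx fy p_def q_def power_mult_distrib)
  have w1: "0 < cmod (1 - w)" unfolding w_def by (rule one_minus_cinner_pos) (use x y in auto)
  have wab: "1 - cinner (f x) (f y) = 1 - of_real (a * b) * w"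
    by (simp add: fx fy w_def cinner_scaleR_left cinner_scaleR_right)
  then have w2: "0 < cmod (1 - of_real (a * b) * w)"
    using one_minus_cinner_pos[OF into[OF x(1)], of "f y"] into[OF y(1)] by simp
  \<comment> \<open>The relative losses of \<open>1 - |x|\<^sup>2\<close> and \<open>1 - |y|\<^sup>2\<close> when passing to the images.\<close>
  define \<kappa> \<mu> where "\<kappa> = (a\<^sup>2 - 1) * (1 / (1 - p) - 1)" and "\<mu> = (b\<^sup>2 - 1) * (1 / (1 - q) - 1)"
  have \<kappa>: "1 - a\<^sup>2 * p = (1 - p) * (1 - \<kappa>)" using p by (simp add: \<kappa>_def field_simps)
  have \<mu>: "1 - b\<^sup>2 * q = (1 - q) * (1 - \<mu>)" using q by (simp add: \<mu>_def field_simps)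
  have \<kappa>1: "\<kappa> < 1" using ap \<kappa> p by (metis diff_gt_0_iff_gt zero_less_mult_pos)
  have \<mu>1: "\<mu> < 1" using bq \<mu> q by (metis diff_gt_0_iff_gt zero_less_mult_pos)
  have \<kappa>0: "0 \<le> \<kappa>" and \<mu>0: "0 \<le> \<mu>" using ab p q by (simp_all add: \<kappa>_def \<mu>_def)
  have "(1 - p) * (1 - q) / (cmod (1 - w))\<^sup>2
      \<le> (1 - a\<^sup>2 * p) * (1 - b\<^sup>2 * q) / (cmod (1 - of_real (a * b) * w))\<^sup>2"
    using hsigma_nonexpansive[OF x(1) y(1)] unfolding hsigma_def wab
    by (simp add: fx fy p_def q_def w_def power_mult_distrib)
  also have "\<dots> = (1 - p) * (1 - q) * ((1 - \<kappa>) * (1 - \<mu>) / (cmod (1 - of_real (a * b) * w))\<^sup>2)"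
    unfolding \<kappa> \<mu> by simp
  finally have "1 / (cmod (1 - w))\<^sup>2 \<le> (1 - \<kappa>) * (1 - \<mu>) / (cmod (1 - of_real (a * b) * w))\<^sup>2"
    using p q by (simp add: divide_inverse mult.assoc)
  then have "(cmod (1 - of_real (a * b) * w))\<^sup>2 \<le> (1 - \<kappa>) * (1 - \<mu>) * (cmod (1 - w))\<^sup>2"
    using w1 w2 by (simp add: field_simps)
  \<comment> \<open>The arithmetic-geometric mean inequality makes the right-hand side a square.\<close>
  also have "\<dots> \<le> (1 - (\<kappa> + \<mu>) / 2)\<^sup>2 * (cmod (1 - w))\<^sup>2"
  proof (rule mult_right_mono)
    have "(1 - (\<kappa> + \<mu>) / 2)\<^sup>2 - (1 - \<kappa>) * (1 - \<mu>) = ((\<kappa> - \<mu>) / 2)\<^sup>2"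
      by (simp add: power2_eq_square field_simps)
    then show "(1 - \<kappa>) * (1 - \<mu>) \<le> (1 - (\<kappa> + \<mu>) / 2)\<^sup>2" by (smt (verit) zero_le_power2)
  qed simp
  also have "\<dots> = ((1 - (\<kappa> + \<mu>) / 2) * cmod (1 - w))\<^sup>2" by (simp add: power_mult_distrib)
  finally have key: "cmod (1 - of_real (a * b) * w) \<le> (1 - (\<kappa> + \<mu>) / 2) * cmod (1 - w)"
    by (rule power2_le_imp_le) (use \<kappa>1 \<mu>1 in simp)
  define \<omega> where "\<omega> = 1 / (1 - w)"
  have w_ne: "1 - w \<noteq> 0" using w1 by auto
  have ww: "1 - w = 1 / \<omega>" by (simp add: \<omega>_def)
  \<comment> \<open>Since \<open>w / (1 - w) = \<omega> - 1\<close>, the quotient \<open>(1 - a b w) / (1 - w)\<close> is affine in \<open>\<omega>\<close>; only its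
    real part is kept.\<close>
  have "1 - of_real (a * b - 1) * (\<omega> - 1) = (1 - of_real (a * b) * w) / (1 - w)"
    unfolding \<omega>_def using w_ne by (simp add: field_simps)
  then have "cmod (1 - of_real (a * b - 1) * (\<omega> - 1)) \<le> 1 - (\<kappa> + \<mu>) / 2"
    using key w1 by (simp add: norm_divide divide_le_eq)
  moreover have "Re (1 - of_real (a * b - 1) * (\<omega> - 1)) = 1 - (a * b - 1) * (Re \<omega> - 1)"
    by (simp add: algebra_simps)
  ultimately have "1 - (a * b - 1) * (Re \<omega> - 1) \<le> 1 - (\<kappa> + \<mu>) / 2"
    using complex_Re_le_cmod by (metis order_trans)
  then have "\<kappa> + \<mu> \<le> 2 * ((a * b - 1) * (Re \<omega> - 1))" by argo
  then have le: "\<kappa> + \<mu> \<le> 2 * (a * b - 1) * (Re \<omega> - 1)" by (simp only: mult.assoc)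
  have ab1: "0 < a * b - 1" using ab less_1_mult[of a b] by simp
  have "0 \<le> 2 * (a * b - 1) * (Re \<omega> - 1)" using le \<kappa>0 \<mu>0 by linarith
  then have W1: "1 \<le> Re \<omega>" using ab1 by (simp add: zero_le_mult_iff)
  have "2 * (a * b - 1) \<le> (a\<^sup>2 - 1) + (b\<^sup>2 - 1)" using sum_squares_bound[of a b] by simp
  then have "2 * (a * b - 1) * (Re \<omega> - 1) \<le> ((a\<^sup>2 - 1) + (b\<^sup>2 - 1)) * (Re \<omega> - 1)"
    using W1 by (intro mult_right_mono) auto
  then have mean: "(a\<^sup>2 - 1) * (1 / (1 - p) - Re \<omega>) + (b\<^sup>2 - 1) * (1 / (1 - q) - Re \<omega>) \<le> 0"
    using le unfolding \<kappa>_def \<mu>_def by (simp add: algebra_simps)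
  have prod: "(Re \<omega>)\<^sup>2 \<le> 1 / (1 - p) * (1 / (1 - q))"
  proof -
    have "(1 - p) * (1 - q) \<le> (cmod (1 - w))\<^sup>2"
      using hsigma_le_1[OF x(1) y(1)] w1 unfolding hsigma_def p_def q_def w_def
      by (simp add: divide_le_eq)
    then have "1 / (cmod (1 - w))\<^sup>2 \<le> 1 / ((1 - p) * (1 - q))"
      using p q w1 by (intro divide_left_mono) auto
    moreover have "(Re \<omega>)\<^sup>2 \<le> (cmod \<omega>)\<^sup>2" by (simp add: cmod_power2)
    ultimately show ?thesis by (simp add: \<omega>_def norm_divide power_divide)
  qed
  have "1 < b\<^sup>2" "b\<^sup>2 \<le> a\<^sup>2" using ab by (simp_all add: power_mono one_less_power)
  then have "1 / (1 - p) \<le> Re \<omega>"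
    using p q by (intro weighted_mean_bound[OF mean _ _ prod]) simp_all
  then have "1 / (1 - p) \<le> cmod \<omega>" using complex_Re_le_cmod[of \<omega>] by linarith
  then have "1 / cmod \<omega> \<le> 1 / (1 / (1 - p))" using p by (intro frac_le) auto
  then have "1 / cmod \<omega> \<le> 1 - p" by simp
  then have "cmod (1 - w) \<le> 1 - p" unfolding ww by (simp add: norm_divide)
  then have "Re (1 - w) \<le> 1 - p" using complex_Re_le_cmod[of "1 - w"] by linarith
  then show ?thesis unfolding norm_diff_sq p_def q_def w_def by simp
qed

end

section \<open>Balls in finite complex dimension\<close>

lemma compact_bounded_combinations:
  fixes C :: "'a::real_normed_vector set"
  assumes "finite C"
  shows "compact {\<Sum>c\<in>C. u c *\<^sub>R c | u. \<forall>c\<in>C. \<bar>u c\<bar> \<le> (M c :: real)}"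
  using assms
proof (induction C rule: finite_induct)
  case empty
  have "{\<Sum>c\<in>{}. u c *\<^sub>R c | u. \<forall>c\<in>{}. \<bar>u c\<bar> \<le> (M c :: real)} = {0 :: 'a}" by auto
  then show ?case by (simp only: compact_insert compact_empty)
next
  case (insert b C)
  let ?K = "{\<Sum>c\<in>C. u c *\<^sub>R c | u. \<forall>c\<in>C. \<bar>u c\<bar> \<le> M c}"
  let ?B = "(\<lambda>r. r *\<^sub>R b) ` {- M b .. M b}"
  have "compact ?B" by (intro compact_continuous_image continuous_intros compact_Icc)
  then have "compact {x + y | x y. x \<in> ?B \<and> y \<in> ?K}" using insert.IH by (rule compact_sums)
  also have "{x + y | x y. x \<in> ?B \<and> y \<in> ?K}
      = {\<Sum>c\<in>insert b C. u c *\<^sub>R c | u. \<forall>c\<in>insert b C. \<bar>u c\<bar> \<le> M c}" (is "?L = ?R")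
  proof
    show "?L \<subseteq> ?R"
    proof
      fix z assume "z \<in> ?L"
      then obtain r u where z: "z = r *\<^sub>R b + (\<Sum>c\<in>C. u c *\<^sub>R c)" and r: "\<bar>r\<bar> \<le> M b"
        and u: "\<forall>c\<in>C. \<bar>u c\<bar> \<le> M c" by auto
      have "(\<Sum>c\<in>C. u c *\<^sub>R c) = (\<Sum>c\<in>C. (u(b := r)) c *\<^sub>R c)"
        using insert.hyps by (intro sum.cong) auto
      then have "z = (\<Sum>c\<in>insert b C. (u(b := r)) c *\<^sub>R c)"
        using insert.hyps z by simp
      then show "z \<in> ?R" using r u by (intro CollectI exI[of _ "u(b := r)"]) auto
    qed
    show "?R \<subseteq> ?L"
    proof
      fix z assume "z \<in> ?R"
      then obtain u where z: "z = (\<Sum>c\<in>insert b C. u c *\<^sub>R c)"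
        and u: "\<forall>c\<in>insert b C. \<bar>u c\<bar> \<le> M c" by auto
      have "z = u b *\<^sub>R b + (\<Sum>c\<in>C. u c *\<^sub>R c)" using insert.hyps z by simp
      moreover have "u b *\<^sub>R b \<in> ?B" using u by (intro imageI) auto
      ultimately show "z \<in> ?L" using u by blast
    qed
  qed
  finally show ?case .
qed

text \<open>A finite complex spanning set together with its multiples by the imaginary unit spans over the
  reals. After orthogonalization, the coefficients of the vectors of a ball are bounded by the
  Cauchy-Schwarz inequality.\<close>

lemma finite_cdim_compact_cball:
  assumes "finite_cdim TYPE('a::complex_inner)"
  shows "compact (cball (0::'a) r)"
proof -
  obtain B :: "'a set" where B: "finite B" "cspan B = UNIV"
    using assms unfolding finite_cdim_def by blast
  define B' where "B' = B \<union> (\<lambda>b. \<i> *\<^sub>C b) ` B"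
  have "cspan B \<subseteq> span B'"
  proof
    fix x assume "x \<in> cspan B"
    then show "x \<in> span B'"
    proof (induction rule: complex_vector.span_induct_alt)
      case base
      show ?case by (rule span_zero)
    next
      case (step c x y)
      have "c *\<^sub>C x = Re c *\<^sub>R x + Im c *\<^sub>R (\<i> *\<^sub>C x)"
        unfolding scaleR_scaleC scaleC_scaleC scaleC_add_left[symmetric]
        by (simp add: complex_eq[of c, symmetric] mult.commute)
      moreover have "x \<in> span B'" "\<i> *\<^sub>C x \<in> span B'"
        using step(1) by (auto simp: B'_def intro!: span_base)
      ultimately show ?case using step by (simp add: span_add span_scale)
    qed
  qed
  then have "span B' = UNIV" using B by auto
  moreover have "finite B'" using B by (simp add: B'_def)
  ultimately obtain C where C: "finite C" "span C = (UNIV :: 'a set)" "pairwise orthogonal C"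
    using basis_orthogonal[of B'] by auto
  \<comment> \<open>The orthogonalized set may contain 0; then \<open>M 0 = 0\<close> by division by zero, which agrees with
    the coefficient \<open>u 0 = 0\<close> chosen below.\<close>
  define M where "M c = \<bar>r\<bar> * norm c / (norm c)\<^sup>2" for c :: 'a
  let ?K = "{\<Sum>c\<in>C. u c *\<^sub>R c | u. \<forall>c\<in>C. \<bar>u c\<bar> \<le> M c}"
  have "cball 0 r \<subseteq> ?K"
  proof
    fix x :: 'a assume x: "x \<in> cball 0 r"
    define u where "u c = inner x c / inner c c" for c
    have "x \<in> span C" using C by simp
    then obtain v where v: "x = (\<Sum>c\<in>C. v c *\<^sub>R c)"
      unfolding span_finite[OF C(1)] by auto
    have uv: "u c *\<^sub>R c = v c *\<^sub>R c" if c: "c \<in> C" for c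
    proof (cases "c = 0")
      case False
      have "inner x c = (\<Sum>d\<in>C. v d * inner d c)" unfolding v by (simp add: inner_sum_left)
      also have "\<dots> = (\<Sum>d\<in>C. if d = c then v c * inner c c else 0)"
        using C(3) c by (intro sum.cong) (auto simp: pairwise_def orthogonal_def)
      also have "\<dots> = v c * inner c c" using C(1) c by simp
      finally show ?thesis using False by (simp add: u_def)
    qed simp
    have "x = (\<Sum>c\<in>C. u c *\<^sub>R c)" unfolding v by (rule sum.cong[OF refl uv[symmetric]])
    moreover have "\<bar>u c\<bar> \<le> M c" for c
    proof -
      have "\<bar>inner x c\<bar> \<le> \<bar>r\<bar> * norm c"
        by (rule order_trans[OF Cauchy_Schwarz_ineq2]) (use x in \<open>auto intro!: mult_right_mono\<close>)
      then show ?thesis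
        unfolding u_def M_def power2_norm_eq_inner by (simp add: divide_right_mono)
    qed
    ultimately show "x \<in> ?K" by blast
  qed
  then have "cball 0 r = ?K \<inter> cball 0 r" by blast
  also have "compact \<dots>" using compact_bounded_combinations[OF C(1)] by (intro compact_Int_closed) auto
  finally show ?thesis .
qed

section \<open>The Wolff point\<close>

text \<open>The equality case of the Cauchy-Schwarz inequality identifies limits on the sphere.\<close>

lemma unit_vectors_cinner_1:
  assumes "norm x \<le> 1" "norm y \<le> 1" "cinner x y = 1"
  shows "x = (y::'a::complex_inner)"
proof -
  have "(norm x)\<^sup>2 \<le> 1" "(norm y)\<^sup>2 \<le> 1" using assms by (simp_all add: power_le_one)
  then have "(norm (x - y))\<^sup>2 \<le> 0" unfolding norm_diff_sq using assms(3) by simp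
  then show ?thesis by simp
qed

context ball_self_map
begin

definition approx_fixed_point :: "real \<Rightarrow> 'a" where
  "approx_fixed_point t = (SOME x. x \<in> ball 0 1 \<and> t *\<^sub>R f x = x)"

lemma approx_fixed_point:
  assumes "0 < t" "t < 1"
  shows "approx_fixed_point t \<in> ball 0 1" "t *\<^sub>R f (approx_fixed_point t) = approx_fixed_point t"
  using someI_ex[of "\<lambda>x. x \<in> ball 0 1 \<and> t *\<^sub>R f x = x"] ex_approximating_fixed_point[OF assms]
  unfolding approx_fixed_point_def by blast+

definition approx_seq :: "nat \<Rightarrow> 'a" where
  "approx_seq k = approx_fixed_point (1 - 1 / (real k + 2))"

lemma approx_param: "0 < 1 - 1 / (real k + 2)" "1 - 1 / (real k + 2) < 1"
  by (simp_all add: field_simps)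

lemma approx_param_mono: "j \<le> k \<Longrightarrow> 1 - 1 / (real j + 2) \<le> 1 - 1 / (real k + 2)"
  by (simp add: frac_le)

lemma approx_param_tendsto: "(\<lambda>k. 1 - 1 / (real k + 2)) \<longlonglongrightarrow> 1"
  by real_asymp

lemmas approx_seq_in = approx_fixed_point(1)[OF approx_param, folded approx_seq_def]
lemmas approx_seq_fixed = approx_fixed_point(2)[OF approx_param, folded approx_seq_def]

lemma approx_seq_dist:
  assumes "j \<le> k"
  shows "(norm (approx_seq j - approx_seq k))\<^sup>2 \<le> (norm (approx_seq k))\<^sup>2 - (norm (approx_seq j))\<^sup>2"
  by (rule approximating_fixed_points_dist[OF approx_param(1)[of j] approx_param_mono[OF assms]
        approx_param(2) approx_seq_in approx_seq_fixed approx_seq_in approx_seq_fixed])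

lemma approx_seq_convergent: "convergent approx_seq"
proof -
  define r where "r k = (norm (approx_seq k))\<^sup>2" for k
  have "incseq r"
  proof (rule incseq_SucI)
    show "r k \<le> r (Suc k)" for k
      using approx_seq_dist[of k "Suc k"] zero_le_power2[of "norm (approx_seq k - approx_seq (Suc k))"]
      unfolding r_def by linarith
  qed
  moreover have "r k \<le> 1" for k using one_minus_norm_sq_pos[OF approx_seq_in[of k]] by (simp add: r_def)
  ultimately obtain L where "r \<longlonglongrightarrow> L" using incseq_convergent by blast
  then have r: "Cauchy r" by (rule LIMSEQ_imp_Cauchy)
  have "Cauchy approx_seq"
  proof (rule CauchyI)
    fix e :: real assume e: "0 < e"
    then obtain N where N: "\<And>m n. N \<le> m \<Longrightarrow> N \<le> n \<Longrightarrow> norm (r m - r n) < e\<^sup>2"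
      using CauchyD[OF r, of "e\<^sup>2"] by auto
    have *: "norm (approx_seq m - approx_seq n) < e" if "N \<le> m" "m \<le> n" for m n
    proof (rule power2_less_imp_less)
      show "(norm (approx_seq m - approx_seq n))\<^sup>2 < e\<^sup>2"
        using approx_seq_dist[OF that(2)] N[of n m] that unfolding r_def by simp
    qed (use e in simp)
    show "\<exists>N. \<forall>m\<ge>N. \<forall>n\<ge>N. norm (approx_seq m - approx_seq n) < e"
      using * by (metis nle_le norm_minus_commute)
  qed
  then show ?thesis by (rule Cauchy_convergent)
qed

text \<open>This is the Wolff point in the classical sense when \<open>f\<close> has no fixed point in the ball; when
  \<open>f\<close> has fixed points, the limit is one of them.\<close>

definition wolff_point :: 'a where "wolff_point = lim approx_seq"

lemma approx_seq_tendsto: "approx_seq \<longlonglongrightarrow> wolff_point"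
  unfolding wolff_point_def using approx_seq_convergent by (simp add: convergent_LIMSEQ_iff)

lemma f_approx_seq: "f (approx_seq k) = (1 / (1 - 1 / (real k + 2))) *\<^sub>R approx_seq k"
proof -
  let ?t = "1 - 1 / (real k + 2)"
  have "f (approx_seq k) = (1 / ?t) *\<^sub>R (?t *\<^sub>R f (approx_seq k))"
    using approx_param(1)[of k] by simp
  then show ?thesis unfolding approx_seq_fixed .
qed

lemma f_approx_seq_tendsto: "(\<lambda>k. f (approx_seq k)) \<longlonglongrightarrow> wolff_point"
proof -
  have "(\<lambda>k. (1 / (1 - 1 / (real k + 2))) *\<^sub>R approx_seq k) \<longlonglongrightarrow> (1 / 1) *\<^sub>R wolff_point"
    by (intro tendsto_scaleR tendsto_divide tendsto_const approx_param_tendsto approx_seq_tendsto) simp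
  then show ?thesis by (simp add: f_approx_seq)
qed

lemma norm_wolff_point_le: "norm wolff_point \<le> 1"
  by (rule LIMSEQ_le_const2[OF tendsto_norm[OF approx_seq_tendsto]])
     (use approx_seq_in in \<open>auto simp: less_imp_le\<close>)

lemma norm_wolff_point:
  assumes "\<forall>z\<in>ball 0 1. f z \<noteq> z"
  shows "norm wolff_point = 1"
proof (rule ccontr)
  assume "norm wolff_point \<noteq> 1"
  then have W: "wolff_point \<in> ball 0 1" using norm_wolff_point_le by simp
  have "(\<lambda>k. f (approx_seq k)) \<longlonglongrightarrow> f wolff_point"
    by (rule isCont_tendsto_compose[OF isCont_on_ball[OF W] approx_seq_tendsto])
  then have "f wolff_point = wolff_point" using f_approx_seq_tendsto LIMSEQ_unique by blast
  then show False using assms W by blast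
qed

text \<open>Horoballs at the Wolff point are mapped into themselves. Each approximating fixed point \<open>x\<close>
  satisfies \<open>|x| \<le> |f x|\<close>, so the Schwarz-Pick inequality for \<open>z\<close> and \<open>x\<close> still holds after
  replacing the factor \<open>1 - |f x|\<^sup>2\<close> by \<open>1 - |x|\<^sup>2\<close>. This factor, which may tend to 0, then
  cancels before the passage to the limit.\<close>

lemma wolff_inequality:
  assumes z: "z \<in> ball 0 1"
  shows "(1 - (norm z)\<^sup>2) * (cmod (1 - cinner (f z) wolff_point))\<^sup>2
      \<le> (1 - (norm (f z))\<^sup>2) * (cmod (1 - cinner z wolff_point))\<^sup>2"
proof (rule LIMSEQ_le)
  let ?x = approx_seq
  show "(\<lambda>k. (1 - (norm z)\<^sup>2) * (cmod (1 - cinner (f z) (f (?x k))))\<^sup>2)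
      \<longlonglongrightarrow> (1 - (norm z)\<^sup>2) * (cmod (1 - cinner (f z) wolff_point))\<^sup>2"
    by (intro tendsto_intros tendsto_cinner f_approx_seq_tendsto)
  show "(\<lambda>k. (1 - (norm (f z))\<^sup>2) * (cmod (1 - cinner z (?x k)))\<^sup>2)
      \<longlonglongrightarrow> (1 - (norm (f z))\<^sup>2) * (cmod (1 - cinner z wolff_point))\<^sup>2"
    by (intro tendsto_intros tendsto_cinner approx_seq_tendsto)
  have "(1 - (norm z)\<^sup>2) * (cmod (1 - cinner (f z) (f (?x k))))\<^sup>2
      \<le> (1 - (norm (f z))\<^sup>2) * (cmod (1 - cinner z (?x k)))\<^sup>2" for k
  proof -
    define p p' A B where "p = 1 - (norm (?x k))\<^sup>2" and "p' = 1 - (norm (f (?x k)))\<^sup>2"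
      and "A = (cmod (1 - cinner z (?x k)))\<^sup>2" and "B = (cmod (1 - cinner (f z) (f (?x k))))\<^sup>2"
    have pos: "0 < p" "0 < p'" "0 < A" "0 < B" "0 < 1 - (norm (f z))\<^sup>2"
      unfolding p_def p'_def A_def B_def
      using one_minus_norm_sq_pos[OF approx_seq_in[of k]]
        one_minus_norm_sq_pos[OF into[OF approx_seq_in[of k]]] one_minus_norm_sq_pos[OF into[OF z]]
        one_minus_cinner_pos[OF z, of "?x k"] one_minus_cinner_pos[OF into[OF z], of "f (?x k)"]
        approx_seq_in[of k] into[OF approx_seq_in[of k]] by simp_all
    have "norm (?x k) \<le> norm (f (?x k))"
      unfolding arg_cong[OF approx_seq_fixed[of k], of norm, symmetric] norm_scaleR
      using approx_param[of k] by (intro mult_left_le_one_le) auto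
    then have "p' \<le> p" by (simp add: p_def p'_def)
    have "(1 - (norm z)\<^sup>2) * p / A \<le> (1 - (norm (f z))\<^sup>2) * p' / B"
      using hsigma_nonexpansive[OF z approx_seq_in[of k]]
      by (simp add: hsigma_def p_def p'_def A_def B_def)
    also have "\<dots> \<le> (1 - (norm (f z))\<^sup>2) * p / B"
      using \<open>p' \<le> p\<close> pos by (intro divide_right_mono mult_left_mono) auto
    finally have "p * ((1 - (norm z)\<^sup>2) * B) \<le> p * ((1 - (norm (f z))\<^sup>2) * A)"
      using pos(3,4) by (simp add: field_simps)
    then show ?thesis using pos(1) unfolding A_def B_def by (simp add: mult_le_cancel_left_pos)
  qed
  then show "\<exists>N. \<forall>k\<ge>N. (1 - (norm z)\<^sup>2) * (cmod (1 - cinner (f z) (f (?x k))))\<^sup>2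
      \<le> (1 - (norm (f z))\<^sup>2) * (cmod (1 - cinner z (?x k)))\<^sup>2" by blast
qed

lemma wolff_inequality_iterate:
  assumes z: "z \<in> ball 0 1"
  shows "(1 - (norm z)\<^sup>2) * (cmod (1 - cinner ((f ^^ n) z) wolff_point))\<^sup>2
      \<le> (1 - (norm ((f ^^ n) z))\<^sup>2) * (cmod (1 - cinner z wolff_point))\<^sup>2"
proof -
  define \<phi> where "\<phi> u = (cmod (1 - cinner u wolff_point))\<^sup>2 / (1 - (norm u)\<^sup>2)" for u
  have mono: "\<phi> (f u) \<le> \<phi> u" if "u \<in> ball 0 1" for u
    unfolding \<phi>_def using wolff_inequality[OF that] one_minus_norm_sq_pos[OF that]
      one_minus_norm_sq_pos[OF into[OF that]] by (simp add: field_simps)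
  have "\<phi> ((f ^^ n) z) \<le> \<phi> z"
  proof (induction n)
    case (Suc n)
    then show ?case using mono[OF iterate_into[OF z, of n]] by simp
  qed simp
  then show ?thesis
    unfolding \<phi>_def using one_minus_norm_sq_pos[OF z] one_minus_norm_sq_pos[OF iterate_into[OF z, of n]]
    by (simp add: field_simps)
qed

section \<open>Limits of orbits on the sphere\<close>

lemma limit_on_sphere_eq_wolff_point:
  assumes z: "z \<in> ball 0 1" and lim: "(\<lambda>k. (f ^^ n k) z) \<longlonglongrightarrow> \<eta>" and \<eta>: "norm \<eta> = 1"
  shows "\<eta> = wolff_point"
proof (rule unit_vectors_cinner_1)
  have "(1 - (norm z)\<^sup>2) * (cmod (1 - cinner \<eta> wolff_point))\<^sup>2
      \<le> (1 - (norm \<eta>)\<^sup>2) * (cmod (1 - cinner z wolff_point))\<^sup>2"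
  proof (rule LIMSEQ_le)
    show "(\<lambda>k. (1 - (norm z)\<^sup>2) * (cmod (1 - cinner ((f ^^ n k) z) wolff_point))\<^sup>2)
        \<longlonglongrightarrow> (1 - (norm z)\<^sup>2) * (cmod (1 - cinner \<eta> wolff_point))\<^sup>2"
      by (intro tendsto_intros tendsto_cinner lim)
    show "(\<lambda>k. (1 - (norm ((f ^^ n k) z))\<^sup>2) * (cmod (1 - cinner z wolff_point))\<^sup>2)
        \<longlonglongrightarrow> (1 - (norm \<eta>)\<^sup>2) * (cmod (1 - cinner z wolff_point))\<^sup>2"
      by (intro tendsto_intros lim)
  qed (use wolff_inequality_iterate[OF z] in blast)
  then have "(1 - (norm z)\<^sup>2) * (cmod (1 - cinner \<eta> wolff_point))\<^sup>2 \<le> 0" by (simp add: \<eta>)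
  then have "(cmod (1 - cinner \<eta> wolff_point))\<^sup>2 \<le> 0"
    using one_minus_norm_sq_pos[OF z] by (simp add: mult_le_0_iff)
  then show "cinner \<eta> wolff_point = 1" by simp
qed (use \<eta> norm_wolff_point_le in auto)

text \<open>Along two orbits \<open>hsigma\<close> is bounded below by its initial value, while its numerator tends
  to 0 when one of the orbits tends to the sphere. So its denominator tends to 0 as well.\<close>

lemma limits_agree_if_on_sphere:
  assumes x: "x \<in> ball 0 1" and y: "y \<in> ball 0 1"
    and limx: "(\<lambda>k. (f ^^ n k) x) \<longlonglongrightarrow> \<xi>" and limy: "(\<lambda>k. (f ^^ n k) y) \<longlonglongrightarrow> \<eta>"
    and "norm \<xi> = 1"
  shows "\<eta> = \<xi>"
proof -
  have ineq: "hsigma x y * (cmod (1 - cinner \<xi> \<eta>))\<^sup>2 \<le> (1 - (norm \<xi>)\<^sup>2) * (1 - (norm \<eta>)\<^sup>2)"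
  proof (rule LIMSEQ_le)
    show "(\<lambda>k. hsigma x y * (cmod (1 - cinner ((f ^^ n k) x) ((f ^^ n k) y)))\<^sup>2)
        \<longlonglongrightarrow> hsigma x y * (cmod (1 - cinner \<xi> \<eta>))\<^sup>2"
      by (intro tendsto_intros tendsto_cinner limx limy)
    show "(\<lambda>k. (1 - (norm ((f ^^ n k) x))\<^sup>2) * (1 - (norm ((f ^^ n k) y))\<^sup>2))
        \<longlonglongrightarrow> (1 - (norm \<xi>)\<^sup>2) * (1 - (norm \<eta>)\<^sup>2)"
      by (intro tendsto_intros limx limy)
    have "hsigma x y * (cmod (1 - cinner ((f ^^ m) x) ((f ^^ m) y)))\<^sup>2
        \<le> (1 - (norm ((f ^^ m) x))\<^sup>2) * (1 - (norm ((f ^^ m) y))\<^sup>2)" for m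
      using hsigma_iterate[OF x y, of m] iterate_into[OF x, of m] iterate_into[OF y, of m]
        one_minus_cinner_pos[OF iterate_into[OF x, of m], of "(f ^^ m) y"]
      unfolding hsigma_def[of "(f ^^ m) x"] by (simp add: pos_le_divide_eq)
    then show "\<exists>N. \<forall>k\<ge>N. hsigma x y * (cmod (1 - cinner ((f ^^ n k) x) ((f ^^ n k) y)))\<^sup>2
        \<le> (1 - (norm ((f ^^ n k) x))\<^sup>2) * (1 - (norm ((f ^^ n k) y))\<^sup>2)" by blast
  qed
  then have "hsigma x y * (cmod (1 - cinner \<xi> \<eta>))\<^sup>2 \<le> 0" using assms(5) by simp
  then have "(cmod (1 - cinner \<xi> \<eta>))\<^sup>2 \<le> 0" using hsigma_pos[OF x y] by (simp add: mult_le_0_iff)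
  then have "cinner \<xi> \<eta> = 1" by simp
  moreover have "norm \<eta> \<le> 1"
    by (rule LIMSEQ_le_const2[OF tendsto_norm[OF limy]])
       (use iterate_into[OF y] in \<open>auto simp: less_imp_le\<close>)
  ultimately show ?thesis using unit_vectors_cinner_1[of \<xi> \<eta>] assms(5) by simp
qed

section \<open>Bounded orbits\<close>

text \<open>If the approximating fixed point \<open>x\<close> had \<open>|x|\<^sup>2 > r\<close>, then each step of the orbit would
  bring it closer to \<open>x\<close>: the quantity \<open>|1 - <z,x>|\<^sup>2 / (1 - |z|\<^sup>2)\<close> would
  shrink by a fixed factor \<open>q < 1\<close>, because \<open>f\<close> moves \<open>x\<close> outward. On the ball of radius \<open>r\<close> it is
  at least \<open>(1 - r)\<^sup>2\<close>.\<close>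

lemma bounded_orbit_bounds_approximants:
  assumes y: "\<And>n. norm ((f ^^ n) y) \<le> r" and r: "r < 1"
  shows "(norm (approx_seq k))\<^sup>2 \<le> r"
proof (rule ccontr)
  define x p a where "x = approx_seq k" and "p = (norm (approx_seq k))\<^sup>2"
    and "a = 1 / (1 - 1 / (real k + 2))"
  assume "\<not> (norm (approx_seq k))\<^sup>2 \<le> r"
  then have pr: "r < p" by (simp add: p_def)
  have r0: "0 \<le> r" using y[of 0] norm_ge_zero order_trans by blast
  have a: "1 < a" using approx_param[of k] by (simp add: a_def)
  have fx: "f x = a *\<^sub>R x" unfolding x_def a_def by (rule f_approx_seq)
  have x: "x \<in> ball 0 1" unfolding x_def by (rule approx_seq_in)
  have p1: "p < 1" using one_minus_norm_sq_pos[OF x] by (simp add: p_def x_def)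
  have ap: "a\<^sup>2 * p < 1"
    using one_minus_norm_sq_pos[OF into[OF x]] unfolding fx
    by (simp add: p_def x_def[symmetric] power_mult_distrib)
  have a2: "1 < a\<^sup>2" "a \<le> a\<^sup>2" using a less_1_mult[of a a] by (simp_all add: power2_eq_square)
  have "a * r \<le> a\<^sup>2 * r" using a2 r0 by (intro mult_right_mono)
  also have "\<dots> \<le> a\<^sup>2 * p" using pr by (intro mult_left_mono) auto
  finally have ar: "a * r < 1" using ap by linarith
  \<comment> \<open>A lower bound for \<open>|1 - a w| / |1 - w|\<close> when \<open>|w| \<le> r\<close>.\<close>
  define \<theta> where "\<theta> = (1 - a * r) / (1 - r)"
  have \<theta>: "0 < \<theta>" using ar r by (simp add: \<theta>_def)
  define Y where "Y n = (f ^^ n) y" for n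
  have Y: "Y n \<in> ball 0 1" "norm (Y n) \<le> r" for n using y[of n] r by (simp_all add: Y_def)
  define E where "E n = (cmod (1 - cinner (Y n) x))\<^sup>2 / (1 - (norm (Y n))\<^sup>2)" for n
  define q where "q = (1 - a\<^sup>2 * p) / ((1 - p) * \<theta>\<^sup>2)"
  have low: "1 - r \<le> cmod (1 - cinner (Y n) x)" for n
  proof -
    have "norm (Y n) * norm x \<le> r * 1" using Y(2)[of n] x r0 by (intro mult_mono) auto
    then show ?thesis using one_minus_cinner_lower[of "Y n" x] by simp
  qed
  have step: "E (Suc n) \<le> q * E n" for n
  proof -
    define v w where "v = 1 - cinner (Y (Suc n)) x" and "w = cinner (Y (Suc n)) x"
    have v: "1 - r \<le> cmod v" unfolding v_def by (rule low)
    have "cmod w \<le> norm (Y (Suc n)) * norm x" unfolding w_def by (rule cinner_Cauchy_Schwarz)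
    also have "\<dots> \<le> r * 1" using Y(2)[of "Suc n"] x r0 by (intro mult_mono) auto
    finally have w: "cmod w \<le> r" by simp
    have "cmod v - (a - 1) * cmod w \<le> cmod (v - of_real (a - 1) * w)"
      using norm_triangle_ineq2[of v "of_real (a - 1) * w"] a
      by (simp add: norm_mult del: of_real_diff)
    also have "v - of_real (a - 1) * w = 1 - of_real a * w"
      by (simp add: v_def w_def algebra_simps)
    finally have "cmod v - (a - 1) * r \<le> cmod (1 - of_real a * w)"
      using mult_left_mono[OF w, of "a - 1"] a by linarith
    moreover have "\<theta> * cmod v \<le> cmod v - (a - 1) * r"
    proof -
      define h where "h = (a - 1) * r / (1 - r)"
      have h: "h * (1 - r) = (a - 1) * r" "\<theta> = 1 - h" using r by (simp_all add: h_def \<theta>_def field_simps)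
      have "h * (1 - r) \<le> h * cmod v"
        using v a r r0 by (intro mult_left_mono) (simp_all add: h_def)
      then show ?thesis unfolding h(2) h(1)[symmetric] by (simp add: left_diff_distrib)
    qed
    ultimately have "\<theta> * cmod v \<le> cmod (1 - of_real a * w)" by linarith
    then have "(\<theta> * cmod v)\<^sup>2 \<le> (cmod (1 - of_real a * w))\<^sup>2" using \<theta> by (intro power_mono) auto
    then have vw: "\<theta>\<^sup>2 * (cmod v)\<^sup>2 \<le> (cmod (1 - of_real a * w))\<^sup>2" by (simp add: power_mult_distrib)
    define D D' U where "D = 1 - (norm (Y n))\<^sup>2" and "D' = 1 - (norm (Y (Suc n)))\<^sup>2"
      and "U = (cmod (1 - cinner (Y n) x))\<^sup>2"
    have pos: "0 < D" "0 < D'" "0 < U" "0 < (cmod v)\<^sup>2"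
      unfolding D_def D'_def U_def
      using one_minus_norm_sq_pos[OF Y(1)] low[of n] v r by (auto simp del: zero_less_power2 intro!: zero_less_power)
    have "D * (1 - p) / U \<le> D' * (1 - a\<^sup>2 * p) / (cmod (1 - of_real a * w))\<^sup>2"
      using hsigma_nonexpansive[OF Y(1)[of n] x]
      by (simp add: hsigma_def D_def D'_def U_def p_def x_def[symmetric] Y_def fx w_def
          power_mult_distrib cinner_scaleR_right)
    also have "\<dots> \<le> D' * (1 - a\<^sup>2 * p) / (\<theta>\<^sup>2 * (cmod v)\<^sup>2)"
    proof (rule divide_left_mono[OF vw])
      have "0 < \<theta>\<^sup>2 * (cmod v)\<^sup>2" using \<theta> pos(4) by simp
      then show "0 < (cmod (1 - of_real a * w))\<^sup>2 * (\<theta>\<^sup>2 * (cmod v)\<^sup>2)"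
        using vw by - (rule mult_pos_pos, linarith+)
    qed (use pos(2) ap in simp)
    finally have "(cmod v)\<^sup>2 / D' \<le> (1 - a\<^sup>2 * p) / ((1 - p) * \<theta>\<^sup>2) * (U / D)"
    proof -
      assume le: "D * (1 - p) / U \<le> D' * (1 - a\<^sup>2 * p) / (\<theta>\<^sup>2 * (cmod v)\<^sup>2)"
      have "V / D' \<le> A / (P * T) * (U / D)"
        if "0 < D" "0 < P" "0 < U" "0 < D'" "0 < T" "0 < V" "D * P / U \<le> D' * A / (T * V)"
        for D P U D' T V A :: real
        using that by (simp add: field_simps)
      from this[OF pos(1) _ pos(3,2) _ pos(4) le] show ?thesis using p1 \<theta> by simp
    qed
    then show ?thesis by (simp add: E_def q_def v_def D_def D'_def U_def)
  qed
  have q1: "q < 1"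
  proof -
    \<comment> \<open>The ratio \<open>(1 - a\<^sup>2 p) / (1 - p)\<close> decreases in \<open>p\<close>, and at \<open>p = r\<close> it is at most
      \<open>\<theta>\<^sup>2\<close>, with difference a multiple of \<open>(a - 1)\<^sup>2\<close>.\<close>
    have "p - r < a\<^sup>2 * (p - r)" using a2 pr by simp
    then have "(1 - a\<^sup>2 * p) * (1 - r) < (1 - p) * (1 - a\<^sup>2 * r)" by (simp add: algebra_simps)
    then have "(1 - a\<^sup>2 * p) * (1 - r) * (1 - r) < (1 - p) * (1 - a\<^sup>2 * r) * (1 - r)"
      using r by (intro mult_strict_right_mono) auto
    then have "(1 - a\<^sup>2 * p) * (1 - r)\<^sup>2 < (1 - p) * ((1 - a\<^sup>2 * r) * (1 - r))"
      by (simp only: power2_eq_square[of "1 - r"] mult.assoc)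
    also have "\<dots> \<le> (1 - p) * (1 - a * r)\<^sup>2"
    proof (rule mult_left_mono)
      have "(1 - a * r)\<^sup>2 - (1 - a\<^sup>2 * r) * (1 - r) = r * (a - 1)\<^sup>2"
        by (simp add: power2_eq_square algebra_simps)
      moreover have "0 \<le> r * (a - 1)\<^sup>2" using r0 by simp
      ultimately show "(1 - a\<^sup>2 * r) * (1 - r) \<le> (1 - a * r)\<^sup>2" by linarith
    qed (use p1 in simp)
    finally have "(1 - a\<^sup>2 * p) * (1 - r)\<^sup>2 < (1 - p) * (1 - a * r)\<^sup>2" .
    then have "1 - a\<^sup>2 * p < (1 - p) * \<theta>\<^sup>2"
      using r by (simp add: \<theta>_def power_divide field_simps)
    then show ?thesis using p1 \<theta> by (simp add: q_def)
  qed
  have q0: "0 \<le> q" using ap p1 by (simp add: q_def)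
  have E: "E n \<le> q ^ n * E 0" for n
  proof (induction n)
    case (Suc n)
    have "E (Suc n) \<le> q * E n" by (rule step)
    also have "\<dots> \<le> q * (q ^ n * E 0)" using Suc q0 by (rule mult_left_mono)
    finally show ?case by simp
  qed simp
  have Elow: "(1 - r)\<^sup>2 \<le> E n" for n
  proof -
    have "(1 - r)\<^sup>2 \<le> (cmod (1 - cinner (Y n) x))\<^sup>2" using low[of n] r by (intro power_mono) auto
    also have "\<dots> \<le> E n" unfolding E_def
      using one_minus_norm_sq_pos[OF Y(1)[of n]] by (simp add: le_divide_eq mult_left_le)
    finally show ?thesis .
  qed
  have "(\<lambda>n. q ^ n * E 0) \<longlonglongrightarrow> 0 * E 0"
    by (intro tendsto_mult tendsto_const LIMSEQ_realpow_zero q0 q1)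
  then have "(1 - r)\<^sup>2 \<le> 0 * E 0"
    by (rule LIMSEQ_le_const) (use order_trans[OF Elow E] in blast)
  then show False using r by simp
qed

section \<open>Recurrent points\<close>

text \<open>The iterate with exponent \<open>n (2 * k) - n k\<close> takes the point number \<open>k\<close> of the convergent
  sequence to the point number \<open>2 * k\<close>; both are close to \<open>y\<close>, and the iterate is nonexpansive.\<close>

lemma recurrent_limit_point:
  assumes z: "z \<in> ball 0 1" and n: "strict_mono n"
    and lim: "(\<lambda>k. (f ^^ n k) z) \<longlonglongrightarrow> y" and y: "y \<in> ball 0 1"
  shows "\<exists>m. (\<forall>k. k \<le> m k) \<and> (\<lambda>k. (f ^^ m k) y) \<longlonglongrightarrow> y"
proof (intro exI conjI allI)
  define m where "m k = n (2 * k) - n k" for k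
  show "k \<le> m k" for k
  proof -
    have "n k + j \<le> n (k + j)" for j
    proof (induction j)
      case (Suc j)
      have "n (k + j) < n (k + Suc j)" using n by (simp add: strict_mono_def)
      then show ?case using Suc by simp
    qed simp
    from this[of k] show ?thesis by (simp add: m_def mult_2)
  qed
  define u where "u k = (f ^^ n k) z" for k
  have uin: "u k \<in> ball 0 1" for k unfolding u_def by (rule iterate_into[OF z])
  have mu: "(f ^^ m k) (u k) = u (2 * k)" for k
  proof -
    have "n k \<le> n (2 * k)" using n by (simp add: strict_mono_less_eq)
    then have "m k + n k = n (2 * k)" by (simp add: m_def)
    moreover have "(f ^^ m k) (u k) = (f ^^ (m k + n k)) z" by (simp only: u_def funpow_add o_apply)
    ultimately show ?thesis by (simp add: u_def)
  qed
  have u2: "(\<lambda>k. u (2 * k)) \<longlonglongrightarrow> y"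
    using LIMSEQ_subseq_LIMSEQ[OF lim, of "\<lambda>k. 2 * k"] by (simp add: u_def strict_mono_def o_def)
  have "(\<lambda>k. u (2 * k) - (f ^^ m k) y) \<longlonglongrightarrow> 0"
  proof -
    have "(\<lambda>k. (norm (u (2 * k) - (f ^^ m k) y))\<^sup>2) \<longlonglongrightarrow> 0"
    proof (rule tendsto_sandwich[OF _ _ tendsto_const])
      show "(\<lambda>k. 4 * (1 - hsigma (u k) y) / (1 - (norm (u (2 * k)))\<^sup>2)) \<longlonglongrightarrow> 0"
      proof -
        have "(\<lambda>k. 4 * (1 - hsigma (u k) y) / (1 - (norm (u (2 * k)))\<^sup>2))
            \<longlonglongrightarrow> 4 * (1 - hsigma y y) / (1 - (norm y)\<^sup>2)"
          using one_minus_norm_sq_pos[OF y]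
          by (intro tendsto_intros tendsto_hsigma y u2 lim[folded u_def]) auto
        then show ?thesis by (simp add: hsigma_self[OF y])
      qed
      have "(norm (u (2 * k) - (f ^^ m k) y))\<^sup>2 \<le> 4 * (1 - hsigma (u k) y) / (1 - (norm (u (2 * k)))\<^sup>2)" for k
      proof -
        have "(1 - (norm (u (2 * k)))\<^sup>2) * (norm (u (2 * k) - (f ^^ m k) y))\<^sup>2
            \<le> 4 * (1 - hsigma (u (2 * k)) ((f ^^ m k) y))"
          by (rule norm_diff_sq_le_hsigma[OF uin iterate_into[OF y]])
        also have "\<dots> \<le> 4 * (1 - hsigma (u k) y)"
          using hsigma_iterate[OF uin y, of k "m k"] by (simp add: mu)
        finally show ?thesis
          using one_minus_norm_sq_pos[OF uin[of "2 * k"]] by (simp add: field_simps)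
      qed
      then show "\<forall>\<^sub>F k in sequentially. (norm (u (2 * k) - (f ^^ m k) y))\<^sup>2
          \<le> 4 * (1 - hsigma (u k) y) / (1 - (norm (u (2 * k)))\<^sup>2)" by simp
    qed simp
    from tendsto_real_sqrt[OF this] show ?thesis by (simp add: tendsto_norm_zero_iff)
  qed
  from tendsto_diff[OF u2 this] show "(\<lambda>k. (f ^^ m k) y) \<longlonglongrightarrow> y" by simp
qed

text \<open>Together with nonexpansiveness this says that \<open>f\<close> is an isometry on the orbit of a recurrent
  point: the shifted pair can be pushed forward until it returns near the original one.\<close>

lemma recurrent_orbit_shift:
  assumes y: "y \<in> ball 0 1" and m: "\<And>k. k \<le> m k" and lim: "(\<lambda>k. (f ^^ m k) y) \<longlonglongrightarrow> y"
  shows "hsigma ((f ^^ (i + j)) y) ((f ^^ i) y) \<le> hsigma ((f ^^ j) y) y"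
proof (rule LIMSEQ_le_const)
  show "(\<lambda>k. hsigma ((f ^^ j) ((f ^^ m k) y)) ((f ^^ m k) y)) \<longlonglongrightarrow> hsigma ((f ^^ j) y) y"
    by (intro tendsto_hsigma lim iterate_into y isCont_tendsto_compose[OF isCont_iterate[OF y] lim])
  have "hsigma ((f ^^ (i + j)) y) ((f ^^ i) y) \<le> hsigma ((f ^^ j) ((f ^^ m k) y)) ((f ^^ m k) y)"
    if "i \<le> k" for k
  proof -
    have le: "i \<le> m k" using that m[of k] by simp
    have "hsigma ((f ^^ (i + j)) y) ((f ^^ i) y)
        \<le> hsigma ((f ^^ (m k - i)) ((f ^^ (i + j)) y)) ((f ^^ (m k - i)) ((f ^^ i) y))"
      by (intro hsigma_iterate iterate_into y)
    also have "(f ^^ (m k - i)) ((f ^^ (i + j)) y) = (f ^^ (m k - i + (i + j))) y"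
      by (simp only: funpow_add o_apply)
    also have "m k - i + (i + j) = j + m k" using le by simp
    also have "(f ^^ (m k - i)) ((f ^^ i) y) = (f ^^ (m k - i + i)) y"
      by (simp only: funpow_add o_apply)
    also have "m k - i + i = m k" using le by simp
    finally show ?thesis by (simp only: funpow_add o_apply)
  qed
  then show "\<exists>N. \<forall>k\<ge>N. hsigma ((f ^^ (i + j)) y) ((f ^^ i) y)
      \<le> hsigma ((f ^^ j) ((f ^^ m k) y)) ((f ^^ m k) y)" by blast
qed

text \<open>Calka's argument. Let \<open>N\<close> be the set of positive return times to the neighbourhood
  \<open>hsigma z y \<ge> 3/4\<close> of \<open>y\<close>. By compactness finitely many of the points reached at these times,
  with exponents in \<open>F\<close>, approximate all of them. Since \<open>f\<close> is an isometry on the orbit, every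
  return time \<open>n\<close> beyond the maximum \<open>L\<close> of \<open>F\<close> can be lowered by an element of \<open>F\<close> to another
  return time. As \<open>N\<close> is unbounded, every exponent is at most \<open>L\<close> steps after an element of
  \<open>N\<close> or after 0, and \<open>L\<close> steps take the neighbourhood only to finitely many neighbourhoods
  away from the sphere.\<close>

lemma recurrent_orbit_bounded:
  assumes fin: "compact (cball (0::'a) 1)"
    and y: "y \<in> ball 0 1" and m: "\<And>k. k \<le> m k" and lim: "(\<lambda>k. (f ^^ m k) y) \<longlonglongrightarrow> y"
  shows "\<exists>r<1. \<forall>n. norm ((f ^^ n) y) \<le> r"
proof -
  define N where "N = {n. 0 < n \<and> 3 / 4 \<le> hsigma ((f ^^ n) y) y}"
  define S where "S = (\<lambda>n. (f ^^ n) y) ` N"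
  define c where "c = 3 / 4 * (1 - norm y)\<^sup>2"
  have c: "0 < c" using y by (simp add: c_def)
  have Sc: "(norm s)\<^sup>2 \<le> 1 - c" if s: "s \<in> S" for s
  proof -
    obtain n where n: "s = (f ^^ n) y" "3 / 4 \<le> hsigma ((f ^^ n) y) y"
      using s by (auto simp: S_def N_def)
    then show ?thesis
      using one_minus_norm_sq_ge_hsigma[OF iterate_into[OF y] y n(2)] by (simp add: c_def)
  qed
  obtain F where F: "finite F" "F \<subseteq> N" "S \<subseteq> (\<Union>i\<in>F. ball ((f ^^ i) y) (c / 2))"
  proof -
    have "S \<subseteq> cball 0 1" unfolding S_def using iterate_into[OF y] by (auto simp: less_imp_le)
    then have "closure S \<subseteq> cball 0 1" by (intro closure_minimal) auto
    then have "compact (closure S)"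
      using compact_Int_closed[OF fin closed_closure[of S]] by (simp add: Int_absorb1)
    moreover have "closure S \<subseteq> (\<Union>i\<in>N. ball ((f ^^ i) y) (c / 2))"
    proof
      fix x assume "x \<in> closure S"
      then obtain s where "s \<in> S" "dist s x < c / 2"
        using c by (meson closure_approachable half_gt_zero)
      then show "x \<in> (\<Union>i\<in>N. ball ((f ^^ i) y) (c / 2))" by (auto simp: S_def)
    qed
    ultimately obtain F where "F \<subseteq> N" "finite F" "closure S \<subseteq> (\<Union>i\<in>F. ball ((f ^^ i) y) (c / 2))"
      by (rule compactE_image[OF _ open_ball])
    then show thesis by (intro that[of F] order_trans[OF closure_subset[of S]])
  qed
  obtain L where L: "\<And>i. i \<in> F \<Longrightarrow> i \<le> L"
    using that[of "Max F"] Max_ge[OF F(1)] by blast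
  have descend: "\<exists>i\<in>F. n - i \<in> N" if n: "n \<in> N" "L < n" for n
  proof -
    obtain i where i: "i \<in> F" "norm ((f ^^ n) y - (f ^^ i) y) < c / 2"
      using F(3) n(1) by (force simp: S_def dist_norm norm_minus_commute)
    have "3 / 4 \<le> hsigma ((f ^^ n) y) ((f ^^ i) y)"
      using i F(2) n(1) c by (intro close_imp_hsigma_ge[of _ c] Sc) (auto simp: S_def)
    also have "(f ^^ n) y = (f ^^ (i + (n - i))) y" using L[OF i(1)] n(2) by simp
    also have "hsigma \<dots> ((f ^^ i) y) \<le> hsigma ((f ^^ (n - i)) y) y"
      by (rule recurrent_orbit_shift[OF y m lim])
    finally show ?thesis using L[OF i(1)] n(2) by (intro bexI[OF _ i(1)]) (simp add: N_def)
  qed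
  have gaps: "\<exists>k\<in>insert 0 N. k \<le> j \<and> j \<le> k + L" if "n \<in> N" "j \<le> n" for n j
    using that
  proof (induction n rule: less_induct)
    case (less n)
    show ?case
    proof (cases "L < n")
      case True
      then obtain i where i: "i \<in> F" "n - i \<in> N" using descend less.prems by blast
      then have "0 < i" "i \<le> L" using F(2) L by (auto simp: N_def)
      show ?thesis
      proof (cases "j \<le> n - i")
        case True
        then show ?thesis using less.IH[of "n - i"] i(2) \<open>0 < i\<close> \<open>L < n\<close> by simp
      next
        case False
        then show ?thesis using i(2) \<open>i \<le> L\<close> less.prems by (intro bexI[of _ "n - i"]) auto
      qed
    qed (use less.prems in auto)
  qed
  have unb: "\<exists>n\<in>N. j \<le> n" for j
  proof -
    have "(\<lambda>k. hsigma ((f ^^ m k) y) y) \<longlonglongrightarrow> hsigma y y"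
      by (intro tendsto_hsigma lim tendsto_const y)
    then have "\<forall>\<^sub>F k in sequentially. 3 / 4 < hsigma ((f ^^ m k) y) y"
      by (rule order_tendstoD) (simp add: hsigma_self[OF y])
    then obtain K where K: "\<And>k. K \<le> k \<Longrightarrow> 3 / 4 < hsigma ((f ^^ m k) y) y"
      unfolding eventually_sequentially by blast
    define k where "k = Suc (max K j)"
    have "K \<le> k" "j \<le> k" "0 < k" by (simp_all add: k_def)
    then have "m k \<in> N" "j \<le> m k" using K[of k] m[of k] by (simp_all add: N_def)
    then show ?thesis by blast
  qed
  \<comment> \<open>A lower bound for \<open>1 - |z|\<^sup>2\<close> on the first \<open>L\<close> images of the neighbourhood.\<close>
  define d where "d = Min ((\<lambda>i. 3 / 4 * (1 - norm ((f ^^ i) y))\<^sup>2) ` {..L})"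
  have d: "0 < d" unfolding d_def
    using iterate_into[OF y] by (subst Min_gr_iff) (auto simp: less_le)
  have bound: "(norm ((f ^^ j) y))\<^sup>2 \<le> 1 - d" for j
  proof -
    obtain k where k: "k \<in> insert 0 N" "k \<le> j" "j \<le> k + L" using unb[of j] gaps by blast
    define i where "i = j - k"
    have i: "i \<le> L" "j = i + k" using k by (auto simp: i_def)
    have "3 / 4 \<le> hsigma ((f ^^ k) y) y" using k(1) by (auto simp: N_def hsigma_self[OF y])
    also have "\<dots> \<le> hsigma ((f ^^ i) ((f ^^ k) y)) ((f ^^ i) y)"
      by (intro hsigma_iterate iterate_into y)
    also have "(f ^^ i) ((f ^^ k) y) = (f ^^ j) y" by (simp add: i(2) funpow_add)
    finally have "3 / 4 * (1 - norm ((f ^^ i) y))\<^sup>2 \<le> 1 - (norm ((f ^^ j) y))\<^sup>2"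
      by (intro one_minus_norm_sq_ge_hsigma iterate_into y) auto
    moreover have "d \<le> 3 / 4 * (1 - norm ((f ^^ i) y))\<^sup>2" unfolding d_def using i by (intro Min_le) auto
    ultimately show ?thesis by linarith
  qed
  have "norm ((f ^^ j) y) \<le> sqrt (1 - d)" for j using bound[of j] by (simp add: real_le_rsqrt)
  moreover have "sqrt (1 - d) < 1" using d by simp
  ultimately show ?thesis by blast
qed

end

section \<open>Limit functions of a fixed-point free map\<close>

text \<open>Each point is the centre of a small closed ball that is strictly contained in the unit ball.\<close>

lemma limit_function_pointwise:
  assumes "limit_function (ball 0 1) f l"
  obtains n where "strict_mono n"
    "\<And>z::'a::complex_hilbert_space. z \<in> ball 0 1 \<Longrightarrow> (\<lambda>k. (f ^^ n k) z) \<longlonglongrightarrow> l z"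
proof -
  obtain n where n: "strict_mono n" and lim: "locally_uniform_limit_on (ball 0 1) (\<lambda>k. f ^^ n k) l"
    using assms unfolding limit_function_def by blast
  have "(\<lambda>k. (f ^^ n k) z) \<longlonglongrightarrow> l z" if z: "z \<in> ball 0 1" for z
  proof -
    define e where "e = (1 - norm z) / 2"
    have e: "0 < e" using z by (simp add: e_def)
    have "strictly_contained (cball z e) (ball 0 1)" unfolding strictly_contained_def
    proof (intro exI[of _ e] conjI ballI subsetI)
      fix x w assume "x \<in> cball z e" "w \<in> ball x e"
      then have "dist z x \<le> e" "dist x w < e" by auto
      then have "norm w < norm z + e + e"
        using dist_triangle[of 0 w z] dist_triangle[of z w x] by simp
      then show "w \<in> ball 0 1" by (simp add: e_def)
    qed (rule e)
    then have "uniform_limit (\<Union>{cball z e}) (\<lambda>k. f ^^ n k) l sequentially"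
      using lim e unfolding locally_uniform_limit_on_def by blast
    then show ?thesis by (rule tendsto_uniform_limitI) (use e in auto)
  qed
  then show thesis using that n by blast
qed

theorem theorem5p7:
  fixes D :: "'a::complex_hilbert_space set" and f :: "'a \<Rightarrow> 'a"
  defines "D \<equiv> ball 0 1"
  assumes "f ` D \<subseteq> D"
    and "holomorphic_map_on f D"
    and "\<forall>z\<in>D. f z \<noteq> z"
  shows "(\<exists>\<zeta>\<in>frontier D. \<forall>l. limit_function D f l \<longrightarrow> l ` D \<subseteq> D \<or> l ` D = {\<zeta>}) \<and>
         (finite_cdim TYPE('a) \<longrightarrow> (\<forall>l. limit_function D f l \<longrightarrow> \<not> l ` D \<subseteq> D))"
proof -
  interpret ball_self_map f
    using assms(2,3) unfolding D_def by unfold_locales blast+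
  have W: "norm wolff_point = 1" using norm_wolff_point assms(4) unfolding D_def by blast
  have "l ` D \<subseteq> D \<or> l ` D = {wolff_point}" if l: "limit_function D f l" for l
  proof -
    obtain n where lim: "\<And>z. z \<in> D \<Longrightarrow> (\<lambda>k. (f ^^ n k) z) \<longlonglongrightarrow> l z"
      using limit_function_pointwise[OF l[unfolded D_def]] unfolding D_def by blast
    have le: "norm (l z) \<le> 1" if "z \<in> D" for z
      by (rule LIMSEQ_le_const2[OF tendsto_norm[OF lim[OF that]]])
         (use iterate_into[of z] that in \<open>auto simp: D_def less_imp_le\<close>)
    show ?thesis
    proof (cases "l ` D \<subseteq> D")
      case False
      then obtain x where x: "x \<in> D" "l x \<notin> D" by blast
      then have lx: "norm (l x) = 1" using le[OF x(1)] by (simp add: D_def)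
      have "l y = wolff_point" if "y \<in> D" for y
        using limits_agree_if_on_sphere[OF _ _ lim[OF x(1)] lim[OF that] lx] x(1) that
          limit_on_sphere_eq_wolff_point[OF _ lim[OF x(1)] lx] by (simp add: D_def)
      then have "l ` D = (\<lambda>_. wolff_point) ` D" by (rule image_cong[OF refl])
      also have "\<dots> = {wolff_point}" by (rule image_constant[OF x(1)])
      finally have "l ` D = {wolff_point}" .
      then show ?thesis by blast
    qed blast
  qed
  moreover have "wolff_point \<in> frontier D" using W by (simp add: D_def frontier_ball)
  moreover have "\<not> l ` D \<subseteq> D" if fin: "finite_cdim TYPE('a)" and l: "limit_function D f l" for l
  proof
    assume sub: "l ` D \<subseteq> D"
    obtain n where n: "strict_mono n" and lim: "\<And>z. z \<in> D \<Longrightarrow> (\<lambda>k. (f ^^ n k) z) \<longlonglongrightarrow> l z"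
      using limit_function_pointwise[OF l[unfolded D_def]] unfolding D_def by blast
    have 0: "0 \<in> D" by (simp add: D_def)
    have y: "l 0 \<in> ball 0 1" using sub 0 unfolding D_def by blast
    obtain m where m: "\<And>k. k \<le> m k" "(\<lambda>k. (f ^^ m k) (l 0)) \<longlonglongrightarrow> l 0"
      using recurrent_limit_point[OF 0[unfolded D_def] n lim[OF 0] y] by blast
    obtain r where r: "r < 1" "\<And>k. norm ((f ^^ k) (l 0)) \<le> r"
      using recurrent_orbit_bounded[OF finite_cdim_compact_cball[OF fin] y m] by blast
    have "(norm wolff_point)\<^sup>2 \<le> r"
      by (rule LIMSEQ_le_const2[OF tendsto_power[OF tendsto_norm[OF approx_seq_tendsto]]])
         (use bounded_orbit_bounds_approximants[OF r(2) r(1)] in blast)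
    then show False using W r(1) by simp
  qed
  ultimately show ?thesis by blast
qed

end
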